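(* Let $\Omega\subset\mathbb{R}^3$ be a bounded domain with connected Lipschitz continuous boundary $\Gamma=\partial\Omega$. Let $c_m>0$ be a constant such that $$\|w\|_{\mathsf{L}^2(\Omega)}\le c_m\big(\|\mathrm{curl}\,w\|_{\mathsf{L}^2(\Omega)}^2+\|\mathrm{div}\,w\|_{\mathsf{L}^2(\Omega)}^2\big)^{1/2}$$ for all vector fields $w\in\overset{\circ}{\mathsf{H}}(\mathrm{curl};\Omega)\cap\mathsf{H}(\mathrm{div};\Omega)$, and let $\hat c:=\max\{2,\sqrt5\,c_m\}$. Then: (i) For all $v\in\overset{\circ}{\mathsf{H}}(\mathrm{Grad};\Omega)$, $$\|\mathrm{Grad}\,v\|_{\mathsf{L}^2(\Omega)}\le\hat c\,\|\mathrm{sym}\,\mathrm{Grad}\,v\|_{\mathsf{L}^2(\Omega)}.$$ (ii) $\mathrm{Grad}\,\overset{\circ}{\mathsf{H}}(\mathrm{Grad};\Omega)=\overset{\circ}{\mathsf{H}}(\mathrm{Curl}_0;\Omega)$, and the inequality in (i) holds for all $v\in\mathsf{H}(\mathrm{Grad};\Omega)$ with $\mathrm{Grad}\,v\in\overset{\circ}{\mathsf{H}}(\mathrm{Curl}_0;\Omega)$, that is, with the gradients $\mathrm{grad}\,v_n$, $n=1,2,3$, of the components of $v$ normal at $\Gamma$ (in the generalized sense).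
   Context: $\mathsf{L}^2(\Omega)$ denotes square integrable functions, vector fields or tensor fields on $\Omega$ with values in $\mathbb{R}$, $\mathbb{R}^3$ or $\mathbb{R}^{3\times3}$, respectively, with the usual norm (Euclidean, respectively Frobenius, norm pointwise). $\mathsf{H}(\mathrm{grad};\Omega)$ is the usual Sobolev space $\mathsf{H}^1(\Omega)$ of scalar functions, and $\overset{\circ}{\mathsf{H}}(\mathrm{grad};\Omega)$ is the closure in it of the smooth compactly supported functions on $\Omega$. For vector fields, $\mathsf{H}(\mathrm{curl};\Omega)=\{w\in\mathsf{L}^2(\Omega):\mathrm{curl}\,w\in\mathsf{L}^2(\Omega)\}$ and $\mathsf{H}(\mathrm{div};\Omega)=\{w\in\mathsf{L}^2(\Omega):\mathrm{div}\,w\in\mathsf{L}^2(\Omega)\}$ (weak derivatives), with graph norms. $\overset{\circ}{\mathsf{H}}(\mathrm{curl};\Omega)$ is the closure in $\mathsf{H}(\mathrm{curl};\Omega)$ of the smooth compactly supported vector fields on $\Omega$. It generalizes the tangential boundary condition $\nu\times w|_\Gamma=0$, i.e. $w$ is normal at $\Gamma$, where $\nu$ is the outer unit normal. A constant $c_m$ as in the claim exists for every such $\Omega$ (Maxwell estimate, a known result). $\mathsf{H}(\mathrm{Grad};\Omega)$, respectively $\overset{\circ}{\mathsf{H}}(\mathrm{Grad};\Omega)$, is the space of vector fields $v=(v_1,v_2,v_3)$ with all components in $\mathsf{H}(\mathrm{grad};\Omega)$, respectively $\overset{\circ}{\mathsf{H}}(\mathrm{grad};\Omega)$. $\mathrm{Grad}\,v$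 is the Jacobian of $v$, the tensor field whose $n$-th row is $(\mathrm{grad}\,v_n)^T$. For a tensor field $P:\Omega\to\mathbb{R}^{3\times3}$ with rows in $\mathsf{H}(\mathrm{curl};\Omega)$, $\mathrm{Curl}\,P$ is the tensor field obtained by applying $\mathrm{curl}$ to each row. $\overset{\circ}{\mathsf{H}}(\mathrm{Curl};\Omega)$ is the space of tensor fields with all three rows in $\overset{\circ}{\mathsf{H}}(\mathrm{curl};\Omega)$, and $\overset{\circ}{\mathsf{H}}(\mathrm{Curl}_0;\Omega)=\{P\in\overset{\circ}{\mathsf{H}}(\mathrm{Curl};\Omega):\mathrm{Curl}\,P=0\}$. $\mathrm{sym}\,P=\tfrac12(P+P^T)$ is the symmetric part. *)

theory Defs
  imports "HOL-Analysis.Analysis"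
begin

section \<open>Bounded Lipschitz domains\<close>

text \<open>
  Near each boundary point, after a linear isometry \<open>Q\<close> of the coordinates, the set is the
  strict epigraph of a Lipschitz function of the first two coordinates; in particular it lies
  locally on one side of its boundary. Taking the function to be defined on the whole plane is
  no restriction, since Lipschitz functions extend.
\<close>

definition lipschitz_boundary :: "(real^3) set \<Rightarrow> bool" where
  "lipschitz_boundary \<Omega> \<longleftrightarrow>
     (\<forall>x0\<in>frontier \<Omega>. \<exists>r>0. \<exists>Q::real^3 \<Rightarrow> real^3. \<exists>\<gamma>::real^2 \<Rightarrow> real. \<exists>L.
        orthogonal_transformation Q \<and> L-lipschitz_on UNIV \<gamma> \<and>
        \<Omega> \<inter> ball x0 r = {x \<in> ball x0 r. \<gamma> (vector [Q x $ 1, Q x $ 2]) < Q x $ 3})"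

definition bounded_lipschitz_domain :: "(real^3) set \<Rightarrow> bool" where
  "bounded_lipschitz_domain \<Omega> \<longleftrightarrow>
     open \<Omega> \<and> connected \<Omega> \<and> \<Omega> \<noteq> {} \<and> bounded \<Omega> \<and> lipschitz_boundary \<Omega>"


section \<open>Square integrable fields\<close>

text \<open>
  Fields are total functions of which only the values on \<open>\<Omega>\<close> matter; elements of the function
  spaces below are representatives, and the spaces are closed under equality almost everywhere
  on \<open>\<Omega>\<close>. On \<open>real^3\<close> the norm is the Euclidean, on \<open>real^3^3\<close> the Frobenius norm.
\<close>

definition L2 :: "(real^3) set \<Rightarrow> (real^3 \<Rightarrow> 'b::euclidean_space) set" where
  "L2 \<Omega> = {f. f \<in> borel_measurable (lebesgue_on \<Omega>) \<and>
              integrable (lebesgue_on \<Omega>) (\<lambda>x. (norm (f x))\<^sup>2)}"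

definition L2norm :: "(real^3) set \<Rightarrow> (real^3 \<Rightarrow> 'b::euclidean_space) \<Rightarrow> real" where
  "L2norm \<Omega> f = sqrt (LINT x|lebesgue_on \<Omega>. (norm (f x))\<^sup>2)"


section \<open>Test functions and their classical derivatives\<close>

primrec Ck :: "nat \<Rightarrow> (real^3 \<Rightarrow> 'b::euclidean_space) \<Rightarrow> bool" where
  "Ck 0 f \<longleftrightarrow> continuous_on UNIV f"
| "Ck (Suc k) f \<longleftrightarrow>
     (\<forall>x. f differentiable at x) \<and> (\<forall>h. Ck k (\<lambda>x. frechet_derivative f (at x) h))"

definition test_functions :: "(real^3) set \<Rightarrow> (real^3 \<Rightarrow> 'b::euclidean_space) set" where
  "test_functions \<Omega> =
     {\<phi>. (\<forall>k. Ck k \<phi>) \<and> compact (closure {x. \<phi> x \<noteq> 0}) \<and> closure {x. \<phi> x \<noteq> 0} \<subseteq> \<Omega>}"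

definition partial :: "3 \<Rightarrow> (real^3 \<Rightarrow> 'b::euclidean_space) \<Rightarrow> real^3 \<Rightarrow> 'b" where
  "partial i f x = frechet_derivative f (at x) (axis i 1)"

definition classical_grad :: "(real^3 \<Rightarrow> real) \<Rightarrow> real^3 \<Rightarrow> real^3" where
  "classical_grad f x = (\<chi> i. partial i f x)"

definition classical_div :: "(real^3 \<Rightarrow> real^3) \<Rightarrow> real^3 \<Rightarrow> real" where
  "classical_div f x = (\<Sum>i\<in>UNIV. partial i f x $ i)"

definition classical_curl :: "(real^3 \<Rightarrow> real^3) \<Rightarrow> real^3 \<Rightarrow> real^3" where
  "classical_curl f x =
     vector [partial 2 f x $ 3 - partial 3 f x $ 2,
             partial 3 f x $ 1 - partial 1 f x $ 3,
             partial 1 f x $ 2 - partial 2 f x $ 1]"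


section \<open>Weak derivatives\<close>

definition is_weak_grad :: "(real^3) set \<Rightarrow> (real^3 \<Rightarrow> real) \<Rightarrow> (real^3 \<Rightarrow> real^3) \<Rightarrow> bool" where
  "is_weak_grad \<Omega> u g \<longleftrightarrow>
     (\<forall>\<phi>\<in>test_functions \<Omega>.
        (LINT x|lebesgue_on \<Omega>. u x * classical_div \<phi> x) = - (LINT x|lebesgue_on \<Omega>. g x \<bullet> \<phi> x))"

definition is_weak_curl :: "(real^3) set \<Rightarrow> (real^3 \<Rightarrow> real^3) \<Rightarrow> (real^3 \<Rightarrow> real^3) \<Rightarrow> bool" where
  "is_weak_curl \<Omega> w c \<longleftrightarrow>
     (\<forall>\<phi>\<in>test_functions \<Omega>.
        (LINT x|lebesgue_on \<Omega>. w x \<bullet> classical_curl \<phi> x) = (LINT x|lebesgue_on \<Omega>. c x \<bullet> \<phi> x))"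

definition is_weak_div :: "(real^3) set \<Rightarrow> (real^3 \<Rightarrow> real^3) \<Rightarrow> (real^3 \<Rightarrow> real) \<Rightarrow> bool" where
  "is_weak_div \<Omega> w d \<longleftrightarrow>
     (\<forall>\<phi>\<in>test_functions \<Omega>.
        (LINT x|lebesgue_on \<Omega>. w x \<bullet> classical_grad \<phi> x) = - (LINT x|lebesgue_on \<Omega>. d x * \<phi> x))"

text \<open>
  The operators choose a representative of the weak derivative, which is determined up to
  equality almost everywhere on \<open>\<Omega>\<close>. They are meaningful only on the spaces
  \<open>H_grad\<close>, \<open>H_curl\<close> and \<open>H_div\<close>, respectively.
\<close>

definition wgrad :: "(real^3) set \<Rightarrow> (real^3 \<Rightarrow> real) \<Rightarrow> real^3 \<Rightarrow> real^3" where
  "wgrad \<Omega> u = (SOME g. g \<in> L2 \<Omega> \<and> is_weak_grad \<Omega> u g)"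

definition wcurl :: "(real^3) set \<Rightarrow> (real^3 \<Rightarrow> real^3) \<Rightarrow> real^3 \<Rightarrow> real^3" where
  "wcurl \<Omega> w = (SOME c. c \<in> L2 \<Omega> \<and> is_weak_curl \<Omega> w c)"

definition wdiv :: "(real^3) set \<Rightarrow> (real^3 \<Rightarrow> real^3) \<Rightarrow> real^3 \<Rightarrow> real" where
  "wdiv \<Omega> w = (SOME d. d \<in> L2 \<Omega> \<and> is_weak_div \<Omega> w d)"


section \<open>Sobolev spaces of scalar and vector fields\<close>

definition H_grad :: "(real^3) set \<Rightarrow> (real^3 \<Rightarrow> real) set" where
  "H_grad \<Omega> = {u \<in> L2 \<Omega>. \<exists>g\<in>L2 \<Omega>. is_weak_grad \<Omega> u g}"

definition H_curl :: "(real^3) set \<Rightarrow> (real^3 \<Rightarrow> real^3) set" where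
  "H_curl \<Omega> = {w \<in> L2 \<Omega>. \<exists>c\<in>L2 \<Omega>. is_weak_curl \<Omega> w c}"

definition H_div :: "(real^3) set \<Rightarrow> (real^3 \<Rightarrow> real^3) set" where
  "H_div \<Omega> = {w \<in> L2 \<Omega>. \<exists>d\<in>L2 \<Omega>. is_weak_div \<Omega> w d}"

definition H_grad_norm :: "(real^3) set \<Rightarrow> (real^3 \<Rightarrow> real) \<Rightarrow> real" where
  "H_grad_norm \<Omega> u = sqrt ((L2norm \<Omega> u)\<^sup>2 + (L2norm \<Omega> (wgrad \<Omega> u))\<^sup>2)"

definition H_curl_norm :: "(real^3) set \<Rightarrow> (real^3 \<Rightarrow> real^3) \<Rightarrow> real" where
  "H_curl_norm \<Omega> w = sqrt ((L2norm \<Omega> w)\<^sup>2 + (L2norm \<Omega> (wcurl \<Omega> w))\<^sup>2)"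

definition H0_grad :: "(real^3) set \<Rightarrow> (real^3 \<Rightarrow> real) set" where
  "H0_grad \<Omega> =
     {u \<in> H_grad \<Omega>. \<forall>e>0. \<exists>\<phi>\<in>test_functions \<Omega>. H_grad_norm \<Omega> (\<lambda>x. u x - \<phi> x) < e}"

definition H0_curl :: "(real^3) set \<Rightarrow> (real^3 \<Rightarrow> real^3) set" where
  "H0_curl \<Omega> =
     {w \<in> H_curl \<Omega>. \<forall>e>0. \<exists>\<phi>\<in>test_functions \<Omega>. H_curl_norm \<Omega> (\<lambda>x. w x - \<phi> x) < e}"


section \<open>Row-wise operators and spaces\<close>

text \<open>\<open>P $ n\<close> is the \<open>n\<close>-th row of a matrix \<open>P\<close>.\<close>

definition H_Grad :: "(real^3) set \<Rightarrow> (real^3 \<Rightarrow> real^3) set" where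
  "H_Grad \<Omega> = {v. \<forall>n. (\<lambda>x. v x $ n) \<in> H_grad \<Omega>}"

definition H0_Grad :: "(real^3) set \<Rightarrow> (real^3 \<Rightarrow> real^3) set" where
  "H0_Grad \<Omega> = {v. \<forall>n. (\<lambda>x. v x $ n) \<in> H0_grad \<Omega>}"

definition wGrad :: "(real^3) set \<Rightarrow> (real^3 \<Rightarrow> real^3) \<Rightarrow> real^3 \<Rightarrow> real^3^3" where
  "wGrad \<Omega> v x = (\<chi> n. wgrad \<Omega> (\<lambda>y. v y $ n) x)"

definition wCurl :: "(real^3) set \<Rightarrow> (real^3 \<Rightarrow> real^3^3) \<Rightarrow> real^3 \<Rightarrow> real^3^3" where
  "wCurl \<Omega> P x = (\<chi> n. wcurl \<Omega> (\<lambda>y. P y $ n) x)"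

definition H0_Curl :: "(real^3) set \<Rightarrow> (real^3 \<Rightarrow> real^3^3) set" where
  "H0_Curl \<Omega> = {P. \<forall>n. (\<lambda>x. P x $ n) \<in> H0_curl \<Omega>}"

definition H0_Curl0 :: "(real^3) set \<Rightarrow> (real^3 \<Rightarrow> real^3^3) set" where
  "H0_Curl0 \<Omega> = {P \<in> H0_Curl \<Omega>. AE x in lebesgue_on \<Omega>. wCurl \<Omega> P x = 0}"

text \<open>
  The image of a set of vector fields under \<open>wGrad\<close>, as a set of \<open>L2\<close> classes: all square
  integrable representatives of the gradients are included.
\<close>

definition Grad_image :: "(real^3) set \<Rightarrow> (real^3 \<Rightarrow> real^3) set \<Rightarrow> (real^3 \<Rightarrow> real^3^3) set" where
  "Grad_image \<Omega> V = {P \<in> L2 \<Omega>. \<exists>v\<in>V. AE x in lebesgue_on \<Omega>. P x = wGrad \<Omega> v x}"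

definition sym_part :: "real^3^3 \<Rightarrow> real^3^3" where
  "sym_part P = (1/2) *\<^sub>R (P + transpose P)"

end

theory Submission
  imports Defs
begin

text \<open>
  Part (i) is Korn's first inequality. For fields of test functions the pointwise identity
  \<open>|sym P|\<^sup>2 = 1/2 |P|\<^sup>2 + 1/2 P \<bullet> P\<^sup>T\<close> (lemma \<open>norm_sym_part_sq\<close>) is integrated. Two integrations by parts
  show that the last term contributes half the squared norm of the divergence, so that
  \<open>\<parallel>Grad \<phi>\<parallel>\<^sup>2 \<le> 2 \<parallel>sym Grad \<phi>\<parallel>\<^sup>2\<close> (\<open>Korn_test\<close>). By density the estimate carries over to \<open>H0_Grad\<close>
  (\<open>Korn_H0\<close>). The constant \<open>sqrt 2\<close> found in this way is at most 2, and so at most \<open>c\<close>.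

  For part (ii), gradients of \<open>H0_grad\<close> are limits of gradients of test functions, which are curl-free
  test fields; this gives one inclusion (\<open>wgrad_in_H0_curl\<close>). For the other one, the Maxwell estimate
  is the decisive fact: a field of \<open>H0_curl\<close> whose curl and divergence vanish is zero. Let \<open>w\<close> be a curl-free
  field in \<open>H0_curl\<close>, and project it orthogonally in \<open>L2\<close> onto the closure of the gradients of test
  functions. Because \<open>\<Omega>\<close> is bounded, the Poincare inequality and completeness of \<open>L2\<close> show that the projection
  is again the gradient of an element of \<open>H0_grad\<close> (\<open>gradient_limit_has_potential\<close>). What remains of
  \<open>w\<close> is orthogonal to all gradients of test functions, hence divergence-free; and it still is a curl-free
  field in \<open>H0_curl\<close>. So it vanishes, and \<open>w\<close> is a gradient (\<open>curl_free_has_potential\<close>). Applied row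
  by row, this is the equality of spaces (\<open>Grad_image_eq\<close>). The remaining inequality follows from (i),
  since by that equality a field with normal gradients has the same gradient as some field in \<open>H0_Grad\<close>.

  The operators \<open>wgrad\<close>, \<open>wcurl\<close>, \<open>wdiv\<close> choose representatives. That the choice does not matter is the
  uniqueness of weak derivatives (\<open>weakly_unique\<close>), which rests on the fundamental lemma of the calculus
  of variations (\<open>L2_AE_zero_if_orthogonal_to_tests\<close>).
\<close>

section \<open>Square integrable fields as a Hilbert space\<close>

definition L2inner :: "(real^3) set \<Rightarrow> (real^3 \<Rightarrow> 'b::euclidean_space) \<Rightarrow> (real^3 \<Rightarrow> 'b) \<Rightarrow> real" where
  "L2inner \<Omega> f g = (LINT x|lebesgue_on \<Omega>. f x \<bullet> g x)"

lemma L2_measurable: "f \<in> L2 \<Omega> \<Longrightarrow> f \<in> borel_measurable (lebesgue_on \<Omega>)"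
  by (simp add: L2_def)

lemma L2_inner_integrable:
  assumes "f \<in> L2 \<Omega>" "g \<in> L2 \<Omega>"
  shows "integrable (lebesgue_on \<Omega>) (\<lambda>x. f x \<bullet> g x)"
proof (rule Bochner_Integration.integrable_bound)
  show "integrable (lebesgue_on \<Omega>) (\<lambda>x. (norm (f x))\<^sup>2 + (norm (g x))\<^sup>2)"
    using assms by (auto simp: L2_def)
  show "(\<lambda>x. f x \<bullet> g x) \<in> borel_measurable (lebesgue_on \<Omega>)"
    using assms by (auto simp: L2_def)
  have "norm (a \<bullet> b) \<le> norm ((norm a)\<^sup>2 + (norm b)\<^sup>2)" for a b :: 'a
  proof -
    have "\<bar>a \<bullet> b\<bar> \<le> norm a * norm b" by (rule Cauchy_Schwarz_ineq2)
    also have "\<dots> \<le> (norm a)\<^sup>2 + (norm b)\<^sup>2"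
      using sum_squares_bound[of "norm a" "norm b"] mult_nonneg_nonneg[OF norm_ge_zero norm_ge_zero, of a b]
      by (simp only: mult.assoc)
    finally show ?thesis by simp
  qed
  then show "AE x in lebesgue_on \<Omega>. norm (f x \<bullet> g x) \<le> norm ((norm (f x))\<^sup>2 + (norm (g x))\<^sup>2)"
    by blast
qed

lemma L2_of_integrable_inner:
  "f \<in> borel_measurable (lebesgue_on \<Omega>) \<Longrightarrow> integrable (lebesgue_on \<Omega>) (\<lambda>x. f x \<bullet> f x) \<Longrightarrow> f \<in> L2 \<Omega>"
  by (simp add: L2_def power2_norm_eq_inner)

lemma L2_add:
  assumes "f \<in> L2 \<Omega>" "g \<in> L2 \<Omega>" shows "(\<lambda>x. f x + g x) \<in> L2 \<Omega>"
  using assms L2_inner_integrable[of f \<Omega> g] L2_inner_integrable[of f \<Omega> f] L2_inner_integrable[of g \<Omega> g]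
  by (intro L2_of_integrable_inner)
     (auto dest!: L2_measurable simp: inner_add_left inner_add_right inner_commute)

lemma L2_bounded_linear:
  assumes T: "bounded_linear T" and f: "f \<in> L2 \<Omega>" shows "(\<lambda>x. T (f x)) \<in> L2 \<Omega>"
proof -
  obtain K where K: "\<And>x. norm (T x) \<le> norm x * K" using bounded_linear.bounded[OF T] by blast
  have m: "(\<lambda>x. T (f x)) \<in> borel_measurable (lebesgue_on \<Omega>)"
    using T L2_measurable[OF f] borel_measurable_continuous_onI linear_continuous_on measurable_compose by blast
  have "integrable (lebesgue_on \<Omega>) (\<lambda>x. (norm (T (f x)))\<^sup>2)"
  proof (rule Bochner_Integration.integrable_bound)
    show "integrable (lebesgue_on \<Omega>) (\<lambda>x. K\<^sup>2 * (norm (f x))\<^sup>2)" using f by (simp add: L2_def)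
    show "(\<lambda>x. (norm (T (f x)))\<^sup>2) \<in> borel_measurable (lebesgue_on \<Omega>)" using m by measurable
    have "(norm (T y))\<^sup>2 \<le> K\<^sup>2 * (norm y)\<^sup>2" for y
      using power_mono[OF K norm_ge_zero, of y 2] by (simp add: power_mult_distrib mult.commute)
    then show "AE x in lebesgue_on \<Omega>. norm ((norm (T (f x)))\<^sup>2) \<le> norm (K\<^sup>2 * (norm (f x))\<^sup>2)"
      by simp
  qed
  with m show ?thesis by (simp add: L2_def)
qed

lemma L2_scaleR: "f \<in> L2 \<Omega> \<Longrightarrow> (\<lambda>x. c *\<^sub>R f x) \<in> L2 \<Omega>"
  by (rule L2_bounded_linear[OF bounded_linear_scaleR_right])

lemma L2_minus: "f \<in> L2 \<Omega> \<Longrightarrow> (\<lambda>x. - f x) \<in> L2 \<Omega>"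
  by (rule L2_bounded_linear[OF bounded_linear_minus[OF bounded_linear_ident]])

lemma L2_diff: "f \<in> L2 \<Omega> \<Longrightarrow> g \<in> L2 \<Omega> \<Longrightarrow> (\<lambda>x. f x - g x) \<in> L2 \<Omega>"
  using L2_add[OF _ L2_minus, of f \<Omega> g] by simp

lemma L2_zero: "(\<lambda>x. 0) \<in> L2 \<Omega>" by (simp add: L2_def)

lemma L2_sum: "(\<And>i. i \<in> I \<Longrightarrow> f i \<in> L2 \<Omega>) \<Longrightarrow> (\<lambda>x. \<Sum>i\<in>I. f i x) \<in> L2 \<Omega>"
  by (induction I rule: infinite_finite_induct) (auto intro: L2_zero L2_add)

lemma L2norm_nonneg: "0 \<le> L2norm \<Omega> f" by (simp add: L2norm_def)

lemma L2norm_sq: "(L2norm \<Omega> f)\<^sup>2 = L2inner \<Omega> f f"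
  by (simp add: L2norm_def L2inner_def power2_norm_eq_inner)

lemma L2norm_zero: "L2norm \<Omega> (\<lambda>x. 0) = 0" by (simp add: L2norm_def)

lemma L2inner_commute: "L2inner \<Omega> f g = L2inner \<Omega> g f"
  by (simp add: L2inner_def inner_commute)

lemma L2inner_diff_left:
  "f \<in> L2 \<Omega> \<Longrightarrow> g \<in> L2 \<Omega> \<Longrightarrow> h \<in> L2 \<Omega> \<Longrightarrow> L2inner \<Omega> (\<lambda>x. f x - g x) h = L2inner \<Omega> f h - L2inner \<Omega> g h"
  by (simp add: L2inner_def inner_diff_left L2_inner_integrable)

lemma L2inner_scaleR_left: "L2inner \<Omega> (\<lambda>x. c *\<^sub>R f x) h = c * L2inner \<Omega> f h"
  by (simp add: L2inner_def)

lemma L2inner_diff_right: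
  "f \<in> L2 \<Omega> \<Longrightarrow> g \<in> L2 \<Omega> \<Longrightarrow> h \<in> L2 \<Omega> \<Longrightarrow> L2inner \<Omega> h (\<lambda>x. f x - g x) = L2inner \<Omega> h f - L2inner \<Omega> h g"
  by (simp add: L2inner_def inner_diff_right L2_inner_integrable)

lemma L2inner_scaleR_right: "L2inner \<Omega> h (\<lambda>x. c *\<^sub>R f x) = c * L2inner \<Omega> h f"
  by (simp add: L2inner_def)

lemma L2inner_minus_right: "L2inner \<Omega> h (\<lambda>x. - f x) = - L2inner \<Omega> h f"
  by (simp add: L2inner_def)

lemma L2norm_sq_diff_scaleR:
  assumes "f \<in> L2 \<Omega>" "g \<in> L2 \<Omega>"
  shows "(L2norm \<Omega> (\<lambda>x. f x - t *\<^sub>R g x))\<^sup>2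
    = (L2norm \<Omega> f)\<^sup>2 - 2 * t * L2inner \<Omega> f g + t\<^sup>2 * (L2norm \<Omega> g)\<^sup>2"
  using assms L2_scaleR[of g \<Omega> t]
  unfolding L2norm_sq
  by (simp add: L2inner_diff_left L2inner_diff_right L2_diff L2inner_scaleR_left
      L2inner_scaleR_right L2inner_commute[of \<Omega> g f] algebra_simps power2_eq_square)

lemma quadratic_nonneg_imp:
  fixes a b c :: real
  assumes "\<And>t. 0 \<le> a - 2 * t * b + t\<^sup>2 * c" "0 \<le> c"
  shows "b\<^sup>2 \<le> a * c"
proof (cases "c = 0")
  case True
  have "b = 0"
  proof (rule ccontr)
    assume "b \<noteq> 0"
    then show False using assms(1)[of "(a + 1) / (2 * b)"] True by (simp add: field_simps)
  qed
  then show ?thesis using True by simp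
next
  case False
  then have "c > 0" using assms by simp
  have "0 \<le> a - 2 * (b / c) * b + (b / c)\<^sup>2 * c" by (rule assms)
  also have "\<dots> = a - b\<^sup>2 / c" using \<open>c > 0\<close> by (simp add: field_simps power2_eq_square)
  finally show ?thesis using \<open>c > 0\<close> by (simp add: field_simps)
qed

lemma L2_Cauchy_Schwarz:
  assumes "f \<in> L2 \<Omega>" "g \<in> L2 \<Omega>"
  shows "\<bar>L2inner \<Omega> f g\<bar> \<le> L2norm \<Omega> f * L2norm \<Omega> g"
proof -
  have "(L2inner \<Omega> f g)\<^sup>2 \<le> (L2norm \<Omega> f)\<^sup>2 * (L2norm \<Omega> g)\<^sup>2"
    by (rule quadratic_nonneg_imp) (metis L2norm_sq_diff_scaleR[OF assms] zero_le_power2, simp)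
  then have "\<bar>L2inner \<Omega> f g\<bar>\<^sup>2 \<le> (L2norm \<Omega> f * L2norm \<Omega> g)\<^sup>2" by (simp add: power_mult_distrib)
  then show ?thesis by (rule power2_le_imp_le) (simp add: L2norm_nonneg)
qed

lemma L2norm_triangle:
  assumes "f \<in> L2 \<Omega>" "g \<in> L2 \<Omega>"
  shows "L2norm \<Omega> (\<lambda>x. f x + g x) \<le> L2norm \<Omega> f + L2norm \<Omega> g"
proof (rule power2_le_imp_le)
  have "(L2norm \<Omega> (\<lambda>x. f x + g x))\<^sup>2 = (L2norm \<Omega> f)\<^sup>2 + 2 * L2inner \<Omega> f g + (L2norm \<Omega> g)\<^sup>2"
    using L2norm_sq_diff_scaleR[OF assms, of "-1"] by simp
  also have "\<dots> \<le> (L2norm \<Omega> f + L2norm \<Omega> g)\<^sup>2"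
    using L2_Cauchy_Schwarz[OF assms] by (simp add: power2_sum)
  finally show "(L2norm \<Omega> (\<lambda>x. f x + g x))\<^sup>2 \<le> (L2norm \<Omega> f + L2norm \<Omega> g)\<^sup>2" .
qed (simp add: L2norm_nonneg)

lemma L2norm_diff_commute: "L2norm \<Omega> (\<lambda>x. f x - g x) = L2norm \<Omega> (\<lambda>x. g x - f x)"
  by (simp add: L2norm_def norm_minus_commute)

lemma L2dist_triangle:
  assumes "f \<in> L2 \<Omega>" "g \<in> L2 \<Omega>" "h \<in> L2 \<Omega>"
  shows "L2norm \<Omega> (\<lambda>x. f x - h x) \<le> L2norm \<Omega> (\<lambda>x. f x - g x) + L2norm \<Omega> (\<lambda>x. g x - h x)"
  using L2norm_triangle[OF L2_diff[OF assms(1,2)] L2_diff[OF assms(2,3)]] by simp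

lemma L2norm_le_add_dist:
  assumes "f \<in> L2 \<Omega>" "g \<in> L2 \<Omega>"
  shows "L2norm \<Omega> f \<le> L2norm \<Omega> g + L2norm \<Omega> (\<lambda>x. f x - g x)"
  using L2norm_triangle[OF assms(2) L2_diff[OF assms]] by simp

lemma L2norm_mono:
  assumes "g \<in> L2 \<Omega>" "f \<in> L2 \<Omega>" "\<And>x. x \<in> \<Omega> \<Longrightarrow> norm (f x) \<le> norm (g x)" "\<Omega> \<in> sets lebesgue"
  shows "L2norm \<Omega> f \<le> L2norm \<Omega> g"
  unfolding L2norm_def
  using assms by (intro real_sqrt_le_mono integral_mono) (auto simp: L2_def power_mono)

lemma L2norm_cong_AE:
  assumes "f \<in> L2 \<Omega>" "g \<in> L2 \<Omega>" "AE x in lebesgue_on \<Omega>. f x = g x"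
  shows "L2norm \<Omega> f = L2norm \<Omega> g"
proof -
  have "(LINT x|lebesgue_on \<Omega>. (norm (f x))\<^sup>2) = (LINT x|lebesgue_on \<Omega>. (norm (g x))\<^sup>2)"
    using assms by (intro integral_cong_AE) (auto simp: L2_def)
  then show ?thesis by (simp add: L2norm_def)
qed

lemma L2inner_cong_AE:
  assumes "f \<in> L2 \<Omega>" "g \<in> L2 \<Omega>" "h \<in> L2 \<Omega>" "AE x in lebesgue_on \<Omega>. f x = g x"
  shows "L2inner \<Omega> f h = L2inner \<Omega> g h"
  unfolding L2inner_def using assms
  by (intro integral_cong_AE borel_measurable_inner) (auto simp: L2_def)

lemma L2norm_eq_0_imp_AE:
  assumes "f \<in> L2 \<Omega>" "L2norm \<Omega> f = 0"
  shows "AE x in lebesgue_on \<Omega>. f x = 0"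
proof -
  have "integral\<^sup>L (lebesgue_on \<Omega>) (\<lambda>x. (norm (f x))\<^sup>2) = 0"
    using assms(2) by (simp add: L2norm_def)
  then have "AE x in lebesgue_on \<Omega>. (norm (f x))\<^sup>2 = 0"
    using assms(1) integral_nonneg_eq_0_iff_AE[of "lebesgue_on \<Omega>" "\<lambda>x. (norm (f x))\<^sup>2"]
    by (auto simp: L2_def)
  then show ?thesis by simp
qed

lemma L2inner_tendsto:
  assumes "\<And>k. f k \<in> L2 \<Omega>" "g \<in> L2 \<Omega>" "h \<in> L2 \<Omega>"
    and lim: "(\<lambda>k. L2norm \<Omega> (\<lambda>x. f k x - g x)) \<longlonglongrightarrow> 0"
  shows "(\<lambda>k. L2inner \<Omega> (f k) h) \<longlonglongrightarrow> L2inner \<Omega> g h"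
proof -
  have "(\<lambda>k. L2inner \<Omega> (f k) h - L2inner \<Omega> g h) \<longlonglongrightarrow> 0"
  proof (rule Lim_null_comparison)
    show "\<forall>\<^sub>F k in sequentially. norm (L2inner \<Omega> (f k) h - L2inner \<Omega> g h)
        \<le> L2norm \<Omega> (\<lambda>x. f k x - g x) * L2norm \<Omega> h"
      using L2_Cauchy_Schwarz[OF L2_diff[OF assms(1,2)] assms(3)] assms
      by (simp add: L2inner_diff_left)
    show "(\<lambda>k. L2norm \<Omega> (\<lambda>x. f k x - g x) * L2norm \<Omega> h) \<longlonglongrightarrow> 0"
      using tendsto_mult_left_zero[OF lim] .
  qed
  then show ?thesis by (simp add: LIM_zero_iff)
qed

text \<open>
  The increments \<open>g k = f (Suc k) - f k\<close> are so small that even \<open>\<Sum>k. 2^k * |g k|\<^sup>2\<close> has finite integral. Hence that sum is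
  finite almost everywhere, and \<open>|g k| \<le> (1/2)^k + 2^k * |g k|\<^sup>2\<close> then makes the telescoping series
  converge at such a point. This replaces the usual argument with Minkowski's inequality for the partial
  sums of \<open>|g k|\<close>.
\<close>

lemma L2_Cauchy_subseq:
  fixes f :: "nat \<Rightarrow> real^3 \<Rightarrow> 'b::euclidean_space"
  assumes L2: "\<And>k. f k \<in> L2 \<Omega>"
    and fast: "\<And>k. (L2norm \<Omega> (\<lambda>x. f (Suc k) x - f k x))\<^sup>2 \<le> (1/4)^k"
  shows "\<exists>F\<in>borel_measurable (lebesgue_on \<Omega>). AE x in lebesgue_on \<Omega>. (\<lambda>k. f k x) \<longlonglongrightarrow> F x"
proof -
  let ?M = "lebesgue_on \<Omega>"
  define g where "g k x = f (Suc k) x - f k x" for k x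
  have g: "g k \<in> L2 \<Omega>" for k unfolding g_def[abs_def] by (intro L2_diff L2)
  have [measurable]: "g k \<in> borel_measurable ?M" "f k \<in> borel_measurable ?M" for k
    using g L2 by (auto simp: L2_def)
  have le: "(\<integral>\<^sup>+x. ennreal (2^k * (norm (g k x))\<^sup>2) \<partial>?M) \<le> ennreal ((1/2)^k)" for k
  proof -
    have "(\<integral>\<^sup>+x. ennreal (2^k * (norm (g k x))\<^sup>2) \<partial>?M) = ennreal (LINT x|?M. 2^k * (norm (g k x))\<^sup>2)"
      using g by (intro nn_integral_eq_integral) (auto simp: L2_def)
    also have "(LINT x|?M. 2^k * (norm (g k x))\<^sup>2) = 2^k * (L2norm \<Omega> (g k))\<^sup>2"
      by (simp add: L2norm_def)
    also have "ennreal \<dots> \<le> ennreal (2^k * (1/4)^k)"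
      using fast[of k] by (intro ennreal_leI mult_left_mono) (simp_all add: g_def[abs_def])
    also have "(2::real)^k * (1/4)^k = (1/2)^k" by (simp flip: power_mult_distrib)
    finally show ?thesis .
  qed
  have "(\<integral>\<^sup>+x. (\<Sum>k. ennreal (2^k * (norm (g k x))\<^sup>2)) \<partial>?M)
      = (\<Sum>k. \<integral>\<^sup>+x. ennreal (2^k * (norm (g k x))\<^sup>2) \<partial>?M)"
    by (rule nn_integral_suminf) simp
  also have "\<dots> \<le> (\<Sum>k. ennreal ((1/2)^k))" by (intro suminf_le le) auto
  also have "\<dots> < \<infinity>" by (subst suminf_ennreal2) (auto simp: summable_geometric)
  finally have "AE x in ?M. (\<Sum>k. ennreal (2^k * (norm (g k x))\<^sup>2)) \<noteq> \<infinity>"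
    by (intro nn_integral_PInf_AE) auto
  then have conv: "AE x in ?M. convergent (\<lambda>k. f k x)"
  proof eventually_elim
    case (elim x)
    then have s: "summable (\<lambda>k. 2^k * (norm (g k x))\<^sup>2)"
      by (intro summable_suminf_not_top) auto
    have "summable (\<lambda>k. (1/2)^k + 2^k * (norm (g k x))\<^sup>2)"
      by (intro summable_add s summable_geometric) simp
    then have "summable (\<lambda>k. g k x)"
    proof (rule summable_comparison_test')
      fix k
      define a where "a = norm (g k x)"
      have "a \<le> (1/2)^k + 2^k * a\<^sup>2"
      proof (cases "a \<le> (1/2)^k")
        case True then show ?thesis by (simp add: add_increasing2)
      next
        case False
        then have "1 \<le> 2^k * a" by (simp add: field_simps)
        then have "a * 1 \<le> a * (2^k * a)" by (intro mult_left_mono) (auto simp: a_def)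
        then show ?thesis by (simp add: power2_eq_square mult_ac add_increasing)
      qed
      then show "norm (g k x) \<le> (1/2)^k + 2^k * (norm (g k x))\<^sup>2" by (simp add: a_def)
    qed
    then have "convergent (\<lambda>n. \<Sum>k<n. g k x)" by (simp add: summable_iff_convergent)
    then have "convergent (\<lambda>n. f n x - f 0 x)"
      using sum_lessThan_telescope[of "\<lambda>k. f k x"] by (simp add: g_def)
    then have "convergent (\<lambda>n. (f n x - f 0 x) + f 0 x)" by (intro convergent_add convergent_const)
    then show "convergent (\<lambda>k. f k x)" by simp
  qed
  have "(\<lambda>x. lim (\<lambda>k. f k x)) \<in> borel_measurable ?M" by measurable
  moreover have "AE x in ?M. (\<lambda>k. f k x) \<longlonglongrightarrow> lim (\<lambda>k. f k x)"
    using conv by eventually_elim (simp add: convergent_LIMSEQ_iff)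
  ultimately show ?thesis by (intro bexI[of _ "\<lambda>x. lim (\<lambda>k. f k x)"])
qed

text \<open>
  A rapidly converging subsequence has a pointwise limit almost everywhere; Fatou's lemma turns the
  Cauchy condition into convergence to that limit in the norm.
\<close>

lemma L2_complete:
  fixes f :: "nat \<Rightarrow> real^3 \<Rightarrow> 'b::euclidean_space"
  assumes L2: "\<And>k. f k \<in> L2 \<Omega>"
    and Cauchy: "\<And>e. e > 0 \<Longrightarrow> \<exists>N. \<forall>m\<ge>N. \<forall>n\<ge>N. L2norm \<Omega> (\<lambda>x. f m x - f n x) < e"
  shows "\<exists>F\<in>L2 \<Omega>. (\<lambda>k. L2norm \<Omega> (\<lambda>x. f k x - F x)) \<longlonglongrightarrow> 0"
proof -
  let ?M = "lebesgue_on \<Omega>"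
  have "\<exists>N. \<forall>m\<ge>N. \<forall>n\<ge>N. L2norm \<Omega> (\<lambda>x. f m x - f n x) < (1/2)^k" for k :: nat
    by (rule Cauchy) simp
  then obtain N where N: "\<And>k m n. m \<ge> N k \<Longrightarrow> n \<ge> N k \<Longrightarrow> L2norm \<Omega> (\<lambda>x. f m x - f n x) < (1/2)^k"
    by metis
  define r where "r k = (\<Sum>j\<le>k. N j) + k" for k
  have rN: "N k \<le> r k" for k unfolding r_def by (simp add: member_le_sum trans_le_add1)
  have "strict_mono r" by (rule strict_monoI_Suc) (simp add: r_def)
  have rsuc: "N k \<le> r (Suc k)" for k
    using rN[of k] \<open>strict_mono r\<close> by (metis le_trans lessI less_imp_le strict_monoD)
  have "(L2norm \<Omega> (\<lambda>x. f (r (Suc k)) x - f (r k) x))\<^sup>2 \<le> (1/4)^k" for k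
  proof -
    have "(L2norm \<Omega> (\<lambda>x. f (r (Suc k)) x - f (r k) x))\<^sup>2 \<le> ((1/2)^k)\<^sup>2"
      using N[OF rsuc rN] by (intro power_mono) (auto simp: L2norm_nonneg less_imp_le)
    also have "\<dots> = (1/4)^k" by (simp add: power2_eq_square flip: power_mult_distrib)
    finally show ?thesis .
  qed
  from L2_Cauchy_subseq[of "\<lambda>k. f (r k)", OF L2 this]
  obtain F where [measurable]: "F \<in> borel_measurable ?M"
    and F: "AE x in ?M. (\<lambda>k. f (r k) x) \<longlonglongrightarrow> F x" by blast
  have [measurable]: "f k \<in> borel_measurable ?M" for k using L2 by (auto simp: L2_def)
  have Fatou: "(\<integral>\<^sup>+x. ennreal ((norm (f m x - F x))\<^sup>2) \<partial>?M) \<le> ennreal (e\<^sup>2)"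
    if "\<And>n. n \<ge> K \<Longrightarrow> L2norm \<Omega> (\<lambda>x. f m x - f n x) \<le> e" for e K m
  proof -
    have "(\<integral>\<^sup>+x. ennreal ((norm (f m x - F x))\<^sup>2) \<partial>?M)
        = (\<integral>\<^sup>+x. liminf (\<lambda>k. ennreal ((norm (f m x - f (r k) x))\<^sup>2)) \<partial>?M)"
    proof (rule nn_integral_cong_AE)
      show "AE x in ?M. ennreal ((norm (f m x - F x))\<^sup>2) = liminf (\<lambda>k. ennreal ((norm (f m x - f (r k) x))\<^sup>2))"
        using F
      proof eventually_elim
        case (elim x)
        have "(\<lambda>k. ennreal ((norm (f m x - f (r k) x))\<^sup>2)) \<longlonglongrightarrow> ennreal ((norm (f m x - F x))\<^sup>2)"
          by (intro tendsto_intros tendsto_ennrealI elim)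
        then show ?case by (metis lim_imp_Liminf trivial_limit_sequentially)
      qed
    qed
    also have "\<dots> \<le> liminf (\<lambda>k. \<integral>\<^sup>+x. ennreal ((norm (f m x - f (r k) x))\<^sup>2) \<partial>?M)"
      by (rule nn_integral_liminf) simp
    also have "\<dots> \<le> ennreal (e\<^sup>2)"
    proof (rule Liminf_le)
      show "\<forall>\<^sub>F k in sequentially. (\<integral>\<^sup>+x. ennreal ((norm (f m x - f (r k) x))\<^sup>2) \<partial>?M) \<le> ennreal (e\<^sup>2)"
        using eventually_ge_at_top[of K]
      proof eventually_elim
        case (elim k)
        have "r k \<ge> K" using elim seq_suble[OF \<open>strict_mono r\<close>, of k] by simp
        have "(\<integral>\<^sup>+x. ennreal ((norm (f m x - f (r k) x))\<^sup>2) \<partial>?M)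
            = ennreal ((L2norm \<Omega> (\<lambda>x. f m x - f (r k) x))\<^sup>2)"
          using L2_diff[OF L2[of m] L2[of "r k"]] by (subst nn_integral_eq_integral) (auto simp: L2_def L2norm_def)
        also have "\<dots> \<le> ennreal (e\<^sup>2)"
          using that[OF \<open>r k \<ge> K\<close>] by (intro ennreal_leI power_mono L2norm_nonneg)
        finally show ?case .
      qed
    qed simp
    finally show ?thesis .
  qed
  have mem: "(\<lambda>x. f m x - F x) \<in> L2 \<Omega>" and le: "L2norm \<Omega> (\<lambda>x. f m x - F x) \<le> e"
    if "\<And>n. n \<ge> K \<Longrightarrow> L2norm \<Omega> (\<lambda>x. f m x - f n x) \<le> e" for e K m
  proof -
    have "(\<integral>\<^sup>+x. ennreal ((norm (f m x - F x))\<^sup>2) \<partial>?M) < \<infinity>"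
      by (rule le_less_trans[OF Fatou[of K m e]]) (use that in auto)
    then have int: "integrable ?M (\<lambda>x. (norm (f m x - F x))\<^sup>2)"
      by (intro integrableI_bounded) auto
    then show "(\<lambda>x. f m x - F x) \<in> L2 \<Omega>" by (simp add: L2_def)
    have "0 \<le> e" using that[of K] L2norm_nonneg[of \<Omega> "\<lambda>x. f m x - f K x"] by simp
    have "ennreal (LINT x|?M. (norm (f m x - F x))\<^sup>2) \<le> ennreal (e\<^sup>2)"
      using Fatou[OF that] int by (subst (asm) nn_integral_eq_integral) auto
    then have "(LINT x|?M. (norm (f m x - F x))\<^sup>2) \<le> e\<^sup>2" by simp
    then show "L2norm \<Omega> (\<lambda>x. f m x - F x) \<le> e"
      unfolding L2norm_def using \<open>0 \<le> e\<close> by (metis real_le_lsqrt)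
  qed
  have "(\<lambda>x. f (N 0) x - F x) \<in> L2 \<Omega>"
    by (rule mem[of "N 0" _ 1]) (use N[of 0 "N 0"] in \<open>simp add: less_imp_le\<close>)
  from L2_diff[OF L2[of "N 0"] this] have "F \<in> L2 \<Omega>" by simp
  moreover have "(\<lambda>k. L2norm \<Omega> (\<lambda>x. f k x - F x)) \<longlonglongrightarrow> 0"
  proof (rule LIMSEQ_I)
    fix e :: real assume "e > 0"
    then obtain K where K: "\<And>m n. m \<ge> K \<Longrightarrow> n \<ge> K \<Longrightarrow> L2norm \<Omega> (\<lambda>x. f m x - f n x) < e/2"
      using Cauchy[of "e/2"] by auto
    have "L2norm \<Omega> (\<lambda>x. f m x - F x) \<le> e/2" if "m \<ge> K" for m
      by (rule le[of K]) (use K that in \<open>simp add: less_imp_le\<close>)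
    then show "\<exists>no. \<forall>m\<ge>no. norm (L2norm \<Omega> (\<lambda>x. f m x - F x) - 0) < e"
      using \<open>e > 0\<close> by (intro exI[of _ K]) (force simp: abs_of_nonneg[OF L2norm_nonneg])
  qed
  ultimately show ?thesis by blast
qed

text \<open>
  Orthogonal projection of \<open>w\<close> onto the closure of the subspace \<open>V\<close>, with the projection given as a limit
  of elements of \<open>V\<close>. A minimizing sequence for the distance is Cauchy by the parallelogram law. Varying
  an almost minimal \<open>v k\<close> in the direction \<open>h\<close> bounds the inner product of \<open>w - v k\<close> with \<open>h\<close> by a
  discriminant estimate, and the bound tends to zero.
\<close>

lemma L2_projection:
  fixes w :: "real^3 \<Rightarrow> 'b::euclidean_space"
  assumes V: "V \<subseteq> L2 \<Omega>" "V \<noteq> {}"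
    and V_lin: "\<And>f g a. f \<in> V \<Longrightarrow> g \<in> V \<Longrightarrow> (\<lambda>x. f x + a *\<^sub>R g x) \<in> V"
    and w: "w \<in> L2 \<Omega>"
  shows "\<exists>v g. (\<forall>k::nat. v k \<in> V) \<and> g \<in> L2 \<Omega> \<and> (\<lambda>k. L2norm \<Omega> (\<lambda>x. v k x - g x)) \<longlonglongrightarrow> 0
     \<and> (\<forall>h\<in>V. L2inner \<Omega> (\<lambda>x. w x - g x) h = 0)"
proof -
  define D where "D v = (L2norm \<Omega> (\<lambda>x. w x - v x))\<^sup>2" for v
  define d where "d = (INF v\<in>V. D v)"
  have bdd: "bdd_below (D ` V)" by (rule bdd_belowI[of _ 0]) (auto simp: D_def)
  have d_le: "d \<le> D v" if "v \<in> V" for v unfolding d_def by (rule cINF_lower[OF bdd that])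
  have "\<exists>v\<in>V. D v < d + 1 / Suc k" for k
  proof (rule ccontr)
    assume "\<not> ?thesis"
    then have "d + 1 / Suc k \<le> d"
      unfolding d_def by (intro cINF_greatest V) (auto simp: not_less d_def)
    then show False by simp
  qed
  then obtain v where v: "\<And>k. v k \<in> V" and Dv: "\<And>k. D (v k) < d + 1 / Suc k" by metis
  have vL: "v k \<in> L2 \<Omega>" for k using v V by blast
  have par: "(L2norm \<Omega> (\<lambda>x. v m x - v n x))\<^sup>2 \<le> 2 / Suc m + 2 / Suc n" for m n
  proof -
    \<comment> \<open>Parallelogram law for \<open>a\<close> and \<open>b\<close>: the midpoint of \<open>v m\<close> and \<open>v n\<close> lies in \<open>V\<close>.\<close>
    define a where "a x = w x - v m x" for x
    define b where "b x = w x - v n x" for x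
    have ab: "a \<in> L2 \<Omega>" "b \<in> L2 \<Omega>" unfolding a_def[abs_def] b_def[abs_def] by (intro L2_diff w vL)+
    have mid: "(\<lambda>x. v m x + (1/2) *\<^sub>R (v n x + (-1) *\<^sub>R v m x)) \<in> V" by (intro V_lin v)
    have eq: "w x - (v m x + (1/2) *\<^sub>R (v n x + (-1) *\<^sub>R v m x))
        = (1/2) *\<^sub>R (w x - v m x - (-1) *\<^sub>R (w x - v n x))" for x
      by (rule euclidean_eqI) (simp add: inner_simps field_simps)
    have "4 * d \<le> 4 * (L2norm \<Omega> (\<lambda>x. (1/2) *\<^sub>R (a x - (-1) *\<^sub>R b x)))\<^sup>2"
      using d_le[OF mid] unfolding D_def eq a_def b_def by simp
    also have "\<dots> = (L2norm \<Omega> (\<lambda>x. a x - (-1) *\<^sub>R b x))\<^sup>2"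
      unfolding L2norm_sq by (simp add: L2inner_scaleR_left L2inner_scaleR_right)
    also have "\<dots> = 2 * (L2norm \<Omega> a)\<^sup>2 + 2 * (L2norm \<Omega> b)\<^sup>2 - (L2norm \<Omega> (\<lambda>x. a x - 1 *\<^sub>R b x))\<^sup>2"
      unfolding L2norm_sq_diff_scaleR[OF ab] by simp
    finally have "(L2norm \<Omega> (\<lambda>x. a x - b x))\<^sup>2 \<le> 2 * D (v m) + 2 * D (v n) - 4 * d"
      by (simp add: D_def a_def[abs_def] b_def[abs_def])
    also have "\<dots> \<le> 2 / Suc m + 2 / Suc n" using Dv[of m] Dv[of n] by simp
    finally show ?thesis by (simp add: a_def b_def L2norm_diff_commute[of \<Omega> "v m"])
  qed
  have "\<exists>N. \<forall>m\<ge>N. \<forall>n\<ge>N. L2norm \<Omega> (\<lambda>x. v m x - v n x) < e" if "e > 0" for e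
  proof -
    obtain N :: nat where N: "4 / e\<^sup>2 < N" using reals_Archimedean2 by blast
    have "L2norm \<Omega> (\<lambda>x. v m x - v n x) < e" if "m \<ge> N" "n \<ge> N" for m n
    proof (rule power2_less_imp_less)
      have "0 < N" using N \<open>e > 0\<close> by (metis divide_nonneg_nonneg gr0I not_less of_nat_0 zero_le_numeral zero_le_power2)
      have "2 / Suc m \<le> 2 / N" "2 / Suc n \<le> 2 / N" using that \<open>0 < N\<close> by (auto simp: field_simps)
      then have "(L2norm \<Omega> (\<lambda>x. v m x - v n x))\<^sup>2 \<le> 4 / N" using par[of m n] by simp
      also have "\<dots> < e\<^sup>2" using N \<open>e > 0\<close> \<open>0 < N\<close> by (simp add: field_simps)
      finally show "(L2norm \<Omega> (\<lambda>x. v m x - v n x))\<^sup>2 < e\<^sup>2" .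
    qed (use \<open>e > 0\<close> in simp)
    then show ?thesis by blast
  qed
  from L2_complete[OF vL this] obtain g where g: "g \<in> L2 \<Omega>"
    and vg: "(\<lambda>k. L2norm \<Omega> (\<lambda>x. v k x - g x)) \<longlonglongrightarrow> 0" by auto
  have wv: "(\<lambda>x. w x - v k x) \<in> L2 \<Omega>" for k by (intro L2_diff w vL)
  have wg: "(\<lambda>x. w x - g x) \<in> L2 \<Omega>" by (intro L2_diff w g)
  have lim: "(\<lambda>k. L2norm \<Omega> (\<lambda>x. (w x - v k x) - (w x - g x))) \<longlonglongrightarrow> 0"
    using vg by (simp add: L2norm_diff_commute[of \<Omega> g])
  have "L2inner \<Omega> (\<lambda>x. w x - g x) h = 0" if h: "h \<in> V" for h
  proof -
    have hL: "h \<in> L2 \<Omega>" using h V by blast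
    define i where "i k = L2inner \<Omega> (\<lambda>x. w x - v k x) h" for k
    have i_lim: "(\<lambda>k. (i k)\<^sup>2) \<longlonglongrightarrow> (L2inner \<Omega> (\<lambda>x. w x - g x) h)\<^sup>2"
      unfolding i_def by (intro tendsto_power L2inner_tendsto[OF wv wg hL lim])
    have "(i k)\<^sup>2 \<le> 1 / Suc k * (L2norm \<Omega> h)\<^sup>2" for k
    proof (rule quadratic_nonneg_imp)
      fix t
      have "(\<lambda>x. v k x + t *\<^sub>R h x) \<in> V" by (intro V_lin v h)
      from d_le[OF this] have "d \<le> (L2norm \<Omega> (\<lambda>x. (w x - v k x) - t *\<^sub>R h x))\<^sup>2"
        by (simp add: D_def algebra_simps)
      also have "\<dots> = D (v k) - 2 * t * i k + t\<^sup>2 * (L2norm \<Omega> h)\<^sup>2"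
        by (simp add: L2norm_sq_diff_scaleR[OF wv hL] D_def i_def)
      finally show "0 \<le> 1 / Suc k - 2 * t * i k + t\<^sup>2 * (L2norm \<Omega> h)\<^sup>2" using Dv[of k] by simp
    qed simp
    moreover have "(\<lambda>k. 1 / Suc k * (L2norm \<Omega> h)\<^sup>2) \<longlonglongrightarrow> 0"
      using tendsto_mult_left_zero[OF LIMSEQ_inverse_real_of_nat] by (simp add: inverse_eq_divide)
    ultimately have "(L2inner \<Omega> (\<lambda>x. w x - g x) h)\<^sup>2 \<le> 0"
      by (intro LIMSEQ_le[OF i_lim]) auto
    then show ?thesis by simp
  qed
  with v g vg show ?thesis by blast
qed

section \<open>Calculus of test functions\<close>

lemma Ck_SucI:
  assumes "\<And>x. (f has_derivative f' x) (at x)" "\<And>h. Ck k (\<lambda>x. f' x h)"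
  shows "Ck (Suc k) f"
proof -
  have "frechet_derivative f (at x) = f' x" for x using frechet_derivative_at[OF assms(1)] by simp
  then show ?thesis using assms by (auto simp: differentiable_def)
qed

lemma Ck_Suc_has_derivative:
  "Ck (Suc k) f \<Longrightarrow> (f has_derivative frechet_derivative f (at x)) (at x)"
  by (simp add: frechet_derivative_works)

lemma Ck_SucD: "Ck (Suc k) f \<Longrightarrow> Ck k f"
proof (induction k arbitrary: f)
  case 0
  then show ?case
    by (auto intro!: continuous_at_imp_continuous_on differentiable_imp_continuous_within)
next
  case (Suc k)
  then show ?case by simp
qed

lemma Ck_const: "Ck k (\<lambda>x. c)"
proof (induction k arbitrary: c)
  case (Suc k)
  show ?case by (rule Ck_SucI[OF has_derivative_const Suc])
qed simp

lemma Ck_bounded_linear: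
  assumes T: "bounded_linear T" and "Ck k f"
  shows "Ck k (\<lambda>x. T (f x))"
  using assms(2)
proof (induction k arbitrary: f)
  case 0
  then show ?case using linear_continuous_on_compose[of UNIV f T] T
    by (simp add: bounded_linear.continuous_on)
next
  case (Suc k)
  show ?case
  proof (rule Ck_SucI)
    show "((\<lambda>x. T (f x)) has_derivative (\<lambda>h. T (frechet_derivative f (at x) h))) (at x)" for x
      by (rule bounded_linear.has_derivative[OF T Ck_Suc_has_derivative[OF Suc.prems]])
    show "Ck k (\<lambda>x. T (frechet_derivative f (at x) h))" for h
      using Suc by simp
  qed
qed

lemma Ck_add: "Ck k f \<Longrightarrow> Ck k g \<Longrightarrow> Ck k (\<lambda>x. f x + g x)"
proof (induction k arbitrary: f g)
  case 0
  then show ?case by (simp add: continuous_on_add)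
next
  case (Suc k)
  show ?case
  proof (rule Ck_SucI)
    show "((\<lambda>x. f x + g x) has_derivative
        (\<lambda>h. frechet_derivative f (at x) h + frechet_derivative g (at x) h)) (at x)" for x
      by (rule has_derivative_add[OF Ck_Suc_has_derivative[OF Suc.prems(1)] Ck_Suc_has_derivative[OF Suc.prems(2)]])
    show "Ck k (\<lambda>x. frechet_derivative f (at x) h + frechet_derivative g (at x) h)" for h
      using Suc by simp
  qed
qed

lemma Ck_mult:
  fixes f g :: "real^3 \<Rightarrow> real"
  shows "Ck k f \<Longrightarrow> Ck k g \<Longrightarrow> Ck k (\<lambda>x. f x * g x)"
proof (induction k arbitrary: f g)
  case 0
  then show ?case by (simp add: continuous_on_mult)
next
  case (Suc k)
  show ?case
  proof (rule Ck_SucI)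
    show "((\<lambda>x. f x * g x) has_derivative
        (\<lambda>h. f x * frechet_derivative g (at x) h + frechet_derivative f (at x) h * g x)) (at x)" for x
      by (rule has_derivative_mult[OF Ck_Suc_has_derivative[OF Suc.prems(1)] Ck_Suc_has_derivative[OF Suc.prems(2)]])
    show "Ck k (\<lambda>x. f x * frechet_derivative g (at x) h + frechet_derivative f (at x) h * g x)" for h
      using Suc.prems by (intro Ck_add Suc.IH Ck_SucD[OF Suc.prems(1)] Ck_SucD[OF Suc.prems(2)]) auto
  qed
qed

lemma Ck_prod:
  fixes f :: "'i \<Rightarrow> real^3 \<Rightarrow> real"
  shows "(\<And>i. i \<in> I \<Longrightarrow> Ck k (f i)) \<Longrightarrow> Ck k (\<lambda>x. \<Prod>i\<in>I. f i x)"
  by (induction I rule: infinite_finite_induct) (auto intro: Ck_const Ck_mult)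

lemma compact_closure_subset:
  "closure S \<subseteq> K \<Longrightarrow> compact K \<Longrightarrow> compact (closure S)"
  using compact_Int_closed[of K "closure S"] by (simp add: Int_absorb1)

lemma test_Ck: "\<phi> \<in> test_functions \<Omega> \<Longrightarrow> Ck k \<phi>" by (simp add: test_functions_def)

lemma test_continuous: "\<phi> \<in> test_functions \<Omega> \<Longrightarrow> continuous_on UNIV \<phi>"
  using test_Ck[of \<phi> \<Omega> 0] by simp

lemma test_has_derivative:
  "\<phi> \<in> test_functions \<Omega> \<Longrightarrow> (\<phi> has_derivative frechet_derivative \<phi> (at x)) (at x)"
  by (rule Ck_Suc_has_derivative[OF test_Ck])

lemma test_subsupport:
  assumes "\<phi> \<in> test_functions \<Omega>" "\<And>k. Ck k \<psi>" "\<And>x. x \<notin> closure {x. \<phi> x \<noteq> 0} \<Longrightarrow> \<psi> x = 0"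
  shows "\<psi> \<in> test_functions \<Omega>"
proof -
  have "closure {x. \<psi> x \<noteq> 0} \<subseteq> closure {x. \<phi> x \<noteq> 0}"
    using assms(3) by (intro closure_minimal) auto
  with assms(1,2) compact_closure_subset[OF this] show ?thesis by (auto simp: test_functions_def)
qed

lemma test_directional_derivative:
  assumes "\<phi> \<in> test_functions \<Omega>"
  shows "(\<lambda>x. frechet_derivative \<phi> (at x) h) \<in> test_functions \<Omega>"
proof (rule test_subsupport[OF assms])
  show "Ck k (\<lambda>x. frechet_derivative \<phi> (at x) h)" for k
    using test_Ck[OF assms, of "Suc k"] by simp
next
  fix x assume x: "x \<notin> closure {x. \<phi> x \<noteq> 0}"
  have "(\<phi> has_derivative (\<lambda>h. 0)) (at x)"
  proof (rule has_derivative_transform_within_open[of "\<lambda>x. 0"])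
    show "open (- closure {x. \<phi> x \<noteq> 0})" by (rule open_Compl[OF closed_closure])
    show "\<And>y. y \<in> - closure {x. \<phi> x \<noteq> 0} \<Longrightarrow> 0 = \<phi> y"
      using closure_subset[of "{x. \<phi> x \<noteq> 0}"] by auto
  qed (use x in auto)
  from frechet_derivative_at[OF this] show "frechet_derivative \<phi> (at x) h = 0" by (simp add: fun_eq_iff)
qed

lemma test_partial: "\<phi> \<in> test_functions \<Omega> \<Longrightarrow> partial i \<phi> \<in> test_functions \<Omega>"
  using test_directional_derivative[of \<phi> \<Omega> "axis i 1"] by (simp add: partial_def[abs_def])

lemma test_bounded_linear:
  assumes "bounded_linear T" "\<phi> \<in> test_functions \<Omega>" shows "(\<lambda>x. T (\<phi> x)) \<in> test_functions \<Omega>"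
proof (rule test_subsupport[OF assms(2)])
  show "Ck k (\<lambda>x. T (\<phi> x))" for k by (rule Ck_bounded_linear[OF assms(1) test_Ck[OF assms(2)]])
  show "T (\<phi> x) = 0" if "x \<notin> closure {x. \<phi> x \<noteq> 0}" for x
  proof -
    have "\<phi> x = 0" using that closure_subset[of "{x. \<phi> x \<noteq> 0}"] by auto
    then show ?thesis using linear_0[OF bounded_linear.linear[OF assms(1)]] by simp
  qed
qed

lemma test_zero: "(\<lambda>x. 0) \<in> test_functions \<Omega>"
  by (auto simp: test_functions_def intro: Ck_const)

lemma test_add:
  assumes "\<phi> \<in> test_functions \<Omega>" "\<psi> \<in> test_functions \<Omega>"
  shows "(\<lambda>x. \<phi> x + \<psi> x) \<in> test_functions \<Omega>"
proof -
  have sub: "closure {x. \<phi> x + \<psi> x \<noteq> 0} \<subseteq> closure {x. \<phi> x \<noteq> 0} \<union> closure {x. \<psi> x \<noteq> 0}"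
    unfolding closure_Un[symmetric] by (rule closure_mono) auto
  have "compact (closure {x. \<phi> x \<noteq> 0} \<union> closure {x. \<psi> x \<noteq> 0})"
    using assms by (intro compact_Un) (auto simp: test_functions_def)
  then have "compact (closure {x. \<phi> x + \<psi> x \<noteq> 0})"
    by (rule compact_closure_subset[OF sub])
  then show ?thesis using assms sub by (auto simp: test_functions_def intro: Ck_add)
qed

lemma test_sum: "(\<And>i. i \<in> I \<Longrightarrow> \<phi> i \<in> test_functions \<Omega>) \<Longrightarrow> (\<lambda>x. \<Sum>i\<in>I. \<phi> i x) \<in> test_functions \<Omega>"
  by (induction I rule: infinite_finite_induct) (auto intro: test_zero test_add)

lemma test_scaleR: "\<phi> \<in> test_functions \<Omega> \<Longrightarrow> (\<lambda>x. c *\<^sub>R \<phi> x) \<in> test_functions \<Omega>"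
  by (rule test_bounded_linear[OF bounded_linear_scaleR_right])

lemma test_nth: "\<phi> \<in> test_functions \<Omega> \<Longrightarrow> (\<lambda>x. \<phi> x $ i) \<in> test_functions \<Omega>"
  by (rule test_bounded_linear[OF bounded_linear_vec_nth])

lemma bounded_linear_axis: "bounded_linear (\<lambda>y::'b::euclidean_space. axis i y :: 'b^3)"
  by (rule linear_conv_bounded_linear[THEN iffD1], rule linearI)
    (auto simp: axis_def vec_eq_iff)

lemma vec_as_sum_axis: "(\<chi> i. f i) = (\<Sum>i\<in>UNIV. axis i (f i :: 'b::euclidean_space) :: 'b^3)"
  by (simp add: vec_eq_iff axis_def sum.delta)

lemma test_vec:
  fixes \<phi> :: "3 \<Rightarrow> real^3 \<Rightarrow> 'b::euclidean_space"
  assumes "\<And>i. \<phi> i \<in> test_functions \<Omega>"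
  shows "(\<lambda>x. \<chi> i. \<phi> i x) \<in> test_functions \<Omega>"
  unfolding vec_as_sum_axis by (intro test_sum test_bounded_linear[OF bounded_linear_axis] assms)

lemma L2_nth: "f \<in> L2 \<Omega> \<Longrightarrow> (\<lambda>x. f x $ i) \<in> L2 \<Omega>"
  by (rule L2_bounded_linear[OF bounded_linear_vec_nth])

lemma L2_vec:
  fixes f :: "3 \<Rightarrow> real^3 \<Rightarrow> 'b::euclidean_space"
  assumes "\<And>i. f i \<in> L2 \<Omega>"
  shows "(\<lambda>x. \<chi> i. f i x) \<in> L2 \<Omega>"
  unfolding vec_as_sum_axis by (intro L2_sum L2_bounded_linear[OF bounded_linear_axis] assms)

lemma partial_bounded_linear:
  assumes "bounded_linear T" "\<phi> \<in> test_functions \<Omega>"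
  shows "partial i (\<lambda>x. T (\<phi> x)) x = T (partial i \<phi> x)"
  unfolding partial_def
  by (rule fun_cong[OF frechet_derivative_at[symmetric], OF bounded_linear.has_derivative[OF assms(1) test_has_derivative[OF assms(2)]]])

lemma partial_nth:
  "\<phi> \<in> test_functions \<Omega> \<Longrightarrow> partial i \<phi> x $ j = partial i (\<lambda>y. \<phi> y $ j) x"
  by (simp add: partial_bounded_linear[OF bounded_linear_vec_nth])

lemma partial_scaleR:
  "\<phi> \<in> test_functions \<Omega> \<Longrightarrow> partial i (\<lambda>x. c *\<^sub>R \<phi> x) x = c *\<^sub>R partial i \<phi> x"
  by (rule partial_bounded_linear[OF bounded_linear_scaleR_right])

lemma partial_add:
  assumes "\<phi> \<in> test_functions \<Omega>" "\<psi> \<in> test_functions \<Omega>"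
  shows "partial i (\<lambda>x. \<phi> x + \<psi> x) x = partial i \<phi> x + partial i \<psi> x"
  unfolding partial_def
  by (rule fun_cong[OF frechet_derivative_at[symmetric], OF has_derivative_add[OF test_has_derivative[OF assms(1)] test_has_derivative[OF assms(2)]]])

text \<open>
  The mean value theorem is applied twice: first along \<open>a\<close> to the difference of \<open>f\<close> over the step
  \<open>t b\<close>, and then along \<open>b\<close> to the derivative in direction \<open>a\<close>.
\<close>

lemma second_difference_mean_value:
  fixes f :: "real^3 \<Rightarrow> real"
  assumes "Ck 2 f" "t > 0"
  shows "\<exists>\<sigma> \<tau>. 0 < \<sigma> \<and> \<sigma> < t \<and> 0 < \<tau> \<and> \<tau> < t \<and>
    f (x + t *\<^sub>R a + t *\<^sub>R b) - f (x + t *\<^sub>R a) - f (x + t *\<^sub>R b) + f x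
      = t * (t * frechet_derivative (\<lambda>y. frechet_derivative f (at y) a) (at (x + \<sigma> *\<^sub>R a + \<tau> *\<^sub>R b)) b)"
proof -
  have C: "Ck (Suc (Suc 0)) f" using assms(1) by (simp only: numeral_2_eq_2)
  define D where "D y = frechet_derivative f (at y) a" for y
  have line: "((\<lambda>s. g (p + s *\<^sub>R c)) has_real_derivative frechet_derivative g (at (p + s *\<^sub>R c)) c) (at s)"
    if "Ck (Suc 0) g" for g :: "real^3 \<Rightarrow> real" and p c s
  proof -
    have gd: "(g has_derivative frechet_derivative g (at (p + s *\<^sub>R c))) (at (p + s *\<^sub>R c))"
      by (rule Ck_Suc_has_derivative[OF that])
    have "((\<lambda>s. g (p + s *\<^sub>R c)) has_derivative (\<lambda>h. frechet_derivative g (at (p + s *\<^sub>R c)) (h *\<^sub>R c))) (at s)"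
      by (rule has_derivative_compose[where f = "\<lambda>s. p + s *\<^sub>R c" and f' = "\<lambda>h. h *\<^sub>R c", OF _ gd])
        (auto intro!: derivative_eq_intros)
    moreover have "linear (frechet_derivative g (at (p + s *\<^sub>R c)))"
      by (rule has_derivative_linear[OF gd])
    ultimately show ?thesis
      by (simp add: has_field_derivative_def linear_scale mult.commute[of _ "frechet_derivative g _ _"])
  qed
  have "\<exists>\<sigma>>0. \<sigma> < t \<and> (f ((x + t *\<^sub>R b) + t *\<^sub>R a) - f (x + t *\<^sub>R a))
        - (f ((x + t *\<^sub>R b) + 0 *\<^sub>R a) - f (x + 0 *\<^sub>R a))
      = (t - 0) * (D ((x + t *\<^sub>R b) + \<sigma> *\<^sub>R a) - D (x + \<sigma> *\<^sub>R a))"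
    unfolding D_def
    by (rule MVT2[OF assms(2)]) (intro DERIV_diff line Ck_SucD[OF C])
  then obtain \<sigma> where \<sigma>: "0 < \<sigma>" "\<sigma> < t" and 1: "(f (x + t *\<^sub>R b + t *\<^sub>R a) - f (x + t *\<^sub>R a)) - (f (x + t *\<^sub>R b) - f x)
      = t * (D (x + t *\<^sub>R b + \<sigma> *\<^sub>R a) - D (x + \<sigma> *\<^sub>R a))" by auto
  have "Ck (Suc 0) D" unfolding D_def using C by simp
  then have "\<exists>\<tau>>0. \<tau> < t \<and> D (x + \<sigma> *\<^sub>R a + t *\<^sub>R b) - D (x + \<sigma> *\<^sub>R a + 0 *\<^sub>R b)
      = (t - 0) * frechet_derivative D (at (x + \<sigma> *\<^sub>R a + \<tau> *\<^sub>R b)) b"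
    by (intro MVT2[OF assms(2)] line)
  then obtain \<tau> where \<tau>: "0 < \<tau>" "\<tau> < t" and 2: "D (x + \<sigma> *\<^sub>R a + t *\<^sub>R b) - D (x + \<sigma> *\<^sub>R a)
      = t * frechet_derivative D (at (x + \<sigma> *\<^sub>R a + \<tau> *\<^sub>R b)) b" by auto
  have "f (x + t *\<^sub>R a + t *\<^sub>R b) - f (x + t *\<^sub>R a) - f (x + t *\<^sub>R b) + f x
      = t * (t * frechet_derivative D (at (x + \<sigma> *\<^sub>R a + \<tau> *\<^sub>R b)) b)"
    using 1 2 by (simp add: algebra_simps)
  with \<sigma> \<tau> show ?thesis unfolding D_def by blast
qed

text \<open>
  The second difference of \<open>f\<close> is symmetric in \<open>a\<close> and \<open>b\<close>, so both mixed derivatives attain a common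
  value at points arbitrarily close to \<open>x\<close>; continuity gives equality at \<open>x\<close>.
\<close>

lemma mixed_directional_derivatives:
  fixes f :: "real^3 \<Rightarrow> real"
  assumes "Ck 2 f"
  shows "frechet_derivative (\<lambda>y. frechet_derivative f (at y) a) (at x) b
       = frechet_derivative (\<lambda>y. frechet_derivative f (at y) b) (at x) a"
proof -
  define D where "D a b y = frechet_derivative (\<lambda>y. frechet_derivative f (at y) a) (at y) b" for a b y
  have "Ck (Suc (Suc 0)) f" using assms by (simp only: numeral_2_eq_2)
  then have cont: "isCont (D a b) x" for a b
    unfolding D_def by (simp add: continuous_on_eq_continuous_at)
  define t :: "nat \<Rightarrow> real" where "t n = inverse (real (Suc n))" for n
  have t: "t n > 0" for n by (simp add: t_def)
  have lim: "t \<longlonglongrightarrow> 0" unfolding t_def by (rule LIMSEQ_inverse_real_of_nat)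
  have "\<exists>p q. norm (p - x) \<le> t n * (norm a + norm b) \<and> norm (q - x) \<le> t n * (norm a + norm b) \<and>
      D a b p = D b a q" for n
  proof -
    obtain \<sigma> \<tau> where 1: "0 < \<sigma>" "\<sigma> < t n" "0 < \<tau>" "\<tau> < t n"
      "f (x + t n *\<^sub>R a + t n *\<^sub>R b) - f (x + t n *\<^sub>R a) - f (x + t n *\<^sub>R b) + f x
        = t n * (t n * D a b (x + \<sigma> *\<^sub>R a + \<tau> *\<^sub>R b))"
      using second_difference_mean_value[OF assms t] unfolding D_def by metis
    obtain \<sigma>' \<tau>' where 2: "0 < \<sigma>'" "\<sigma>' < t n" "0 < \<tau>'" "\<tau>' < t n"
      "f (x + t n *\<^sub>R b + t n *\<^sub>R a) - f (x + t n *\<^sub>R b) - f (x + t n *\<^sub>R a) + f x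
        = t n * (t n * D b a (x + \<sigma>' *\<^sub>R b + \<tau>' *\<^sub>R a))"
      using second_difference_mean_value[OF assms t] unfolding D_def by metis
    have "t n * (t n * D a b (x + \<sigma> *\<^sub>R a + \<tau> *\<^sub>R b)) = t n * (t n * D b a (x + \<sigma>' *\<^sub>R b + \<tau>' *\<^sub>R a))"
      using 1(5) 2(5) by (simp add: algebra_simps)
    then have eq: "D a b (x + \<sigma> *\<^sub>R a + \<tau> *\<^sub>R b) = D b a (x + \<sigma>' *\<^sub>R b + \<tau>' *\<^sub>R a)"
      using t[of n] by simp
    have near: "norm (r *\<^sub>R u + s *\<^sub>R v) \<le> t n * (norm u + norm v)"
      if "0 < r" "r < t n" "0 < s" "s < t n" for r s and u v :: "real^3"
    proof -
      have "norm (r *\<^sub>R u + s *\<^sub>R v) \<le> r * norm u + s * norm v"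
        using norm_triangle_ineq[of "r *\<^sub>R u" "s *\<^sub>R v"] that by simp
      also have "\<dots> \<le> t n * norm u + t n * norm v"
        using that by (intro add_mono mult_right_mono) auto
      finally show ?thesis by (simp add: distrib_left)
    qed
    show ?thesis
      using eq near[OF 1(1-4), of a b] near[OF 2(1-4), of b a]
      by (intro exI[of _ "x + \<sigma> *\<^sub>R a + \<tau> *\<^sub>R b"] exI[of _ "x + \<sigma>' *\<^sub>R b + \<tau>' *\<^sub>R a"])
        (simp add: add.assoc add.commute[of "norm b"])
  qed
  then obtain p q where p: "\<And>n. norm (p n - x) \<le> t n * (norm a + norm b)"
    and q: "\<And>n. norm (q n - x) \<le> t n * (norm a + norm b)" and pq: "\<And>n. D a b (p n) = D b a (q n)"
    by metis
  have z: "(\<lambda>n. t n * (norm a + norm b)) \<longlonglongrightarrow> 0" by (rule tendsto_mult_left_zero[OF lim])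
  have "p \<longlonglongrightarrow> x" "q \<longlonglongrightarrow> x"
    using Lim_null_comparison[OF _ z, of "\<lambda>n. p n - x"] Lim_null_comparison[OF _ z, of "\<lambda>n. q n - x"] p q
    by (auto simp: LIM_zero_iff)
  then have "(\<lambda>n. D a b (p n)) \<longlonglongrightarrow> D a b x" "(\<lambda>n. D b a (q n)) \<longlonglongrightarrow> D b a x"
    using cont by (auto intro: isCont_tendsto_compose)
  then show ?thesis using pq LIMSEQ_unique unfolding D_def by simp
qed

lemma partial_commute:
  fixes \<phi> :: "real^3 \<Rightarrow> real"
  shows "\<phi> \<in> test_functions \<Omega> \<Longrightarrow> partial i (partial j \<phi>) x = partial j (partial i \<phi>) x"
  unfolding partial_def[abs_def] by (rule mixed_directional_derivatives[OF test_Ck])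

section \<open>Integration by parts and the Poincare inequality\<close>

lemma compact_subset_cballE:
  assumes "compact K" obtains R where "R > 0" "K \<subseteq> cball 0 R"
proof -
  obtain R where "0 < R" "K \<subseteq> ball 0 R"
    using bounded_subset_ballD[OF compact_imp_bounded[OF assms], of 0] by auto
  then show ?thesis using ball_subset_cball[of 0 R] by (intro that[of R]) auto
qed

lemma integrable_compact_support:
  fixes f :: "real^3 \<Rightarrow> real"
  assumes "continuous_on UNIV f" "compact K" "\<And>x. x \<notin> K \<Longrightarrow> f x = 0"
  shows "integrable lborel f"
proof -
  have "integrable lborel (\<lambda>x. indicator K x *\<^sub>R f x)"
    by (rule borel_integrable_compact[OF assms(2) continuous_on_subset[OF assms(1)]]) simp
  also have "(\<lambda>x. indicator K x *\<^sub>R f x) = f"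
    using assms(3) by (auto simp: indicator_def fun_eq_iff)
  finally show ?thesis .
qed

lemma lebesgue_on_compact_support:
  fixes f :: "real^3 \<Rightarrow> real"
  assumes f: "continuous_on UNIV f" "compact K" "\<And>x. x \<notin> K \<Longrightarrow> f x = 0" and "K \<subseteq> \<Omega>" "\<Omega> \<in> sets lebesgue"
  shows "integrable (lebesgue_on \<Omega>) f" "integral\<^sup>L (lebesgue_on \<Omega>) f = integral\<^sup>L lborel f"
proof -
  have fm: "f \<in> borel_measurable lborel" using f(1) by (simp add: borel_measurable_continuous_onI)
  have eq: "(\<lambda>x. indicator \<Omega> x * f x) = f" using assms(3,4) by (auto simp: indicator_def fun_eq_iff)
  show "integrable (lebesgue_on \<Omega>) f"
    using integrable_compact_support[OF f] fm assms(5)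
    by (simp add: integrable_restrict_space eq integrable_completion)
  show "integral\<^sup>L (lebesgue_on \<Omega>) f = integral\<^sup>L lborel f"
    using fm assms(5) by (simp add: integral_restrict_space eq integral_completion)
qed

lemma integral_lborel_translate:
  fixes f :: "real^3 \<Rightarrow> real"
  assumes "f \<in> borel_measurable borel"
  shows "integral\<^sup>L lborel (\<lambda>x. f (x + c)) = integral\<^sup>L lborel f"
proof -
  have "integral\<^sup>L lborel f = integral\<^sup>L (distr lborel borel ((+) c)) f" by (simp add: lborel_distr_plus)
  also have "\<dots> = integral\<^sup>L lborel (\<lambda>x. f (c + x))" using assms by (subst integral_distr) auto
  finally show ?thesis by (simp add: add.commute)
qed

text \<open>
  Lebesgue measure is translation invariant, so every difference quotient of \<open>f\<close> has integral zero. The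
  quotients are dominated through the mean value theorem and converge to the derivative.
\<close>

lemma integral_directional_derivative_zero:
  fixes f :: "real^3 \<Rightarrow> real"
  assumes deriv: "\<And>x. (f has_derivative f' x) (at x)"
    and cont: "continuous_on UNIV (\<lambda>x. f' x e)"
    and K: "compact K" "\<And>x. x \<notin> K \<Longrightarrow> f x = 0"
    and e: "norm e \<le> 1"
  shows "integral\<^sup>L lborel (\<lambda>x. f' x e) = 0"
proof -
  obtain R where R: "R > 0" "K \<subseteq> cball 0 R" using compact_subset_cballE[OF K(1)] .
  have f0: "f x = 0" if "norm x > R" for x using K(2) R(2) that by fastforce
  have f_cont: "continuous_on UNIV f"
    by (intro continuous_at_imp_continuous_on ballI has_derivative_continuous[OF deriv])
  have f_meas [measurable]: "f \<in> borel_measurable borel"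
    by (rule borel_measurable_continuous_onI[OF f_cont])
  have f_int: "integrable lborel f" by (rule integrable_compact_support[OF f_cont K])
  have lin: "linear (f' x)" for x by (rule has_derivative_linear[OF deriv])
  have line: "((\<lambda>s. f (x + s *\<^sub>R e)) has_real_derivative f' (x + s *\<^sub>R e) e) (at s)" for x s
  proof -
    have "((\<lambda>s. f (x + s *\<^sub>R e)) has_derivative (\<lambda>h. f' (x + s *\<^sub>R e) (h *\<^sub>R e))) (at s)"
      by (rule has_derivative_compose[where f = "\<lambda>s. x + s *\<^sub>R e" and f' = "\<lambda>h. h *\<^sub>R e", OF _ deriv])
        (auto intro!: derivative_eq_intros)
    then show ?thesis
      by (simp add: has_field_derivative_def linear_scale[OF lin] mult.commute[of _ "f' _ e"])
  qed
  have "compact ((\<lambda>x. f' x e) ` cball 0 (R + 1))"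
    by (intro compact_continuous_image continuous_on_subset[OF cont]) auto
  then obtain B where B: "B > 0" "\<And>x. norm x \<le> R + 1 \<Longrightarrow> \<bar>f' x e\<bar> \<le> B"
    by (auto dest!: compact_imp_bounded simp: bounded_pos)
  define t where "t n = inverse (real (Suc n))" for n
  have t: "t n > 0" "t n \<le> 1" for n by (auto simp: t_def field_simps)
  have t0: "t \<longlonglongrightarrow> 0" unfolding t_def by (rule LIMSEQ_inverse_real_of_nat)
  define q where "q n x = (f (x + t n *\<^sub>R e) - f x) / t n" for n x
  have te: "norm (s *\<^sub>R e) \<le> 1" if "0 \<le> s" "s \<le> 1" for s
    using that e mult_mono[of s 1 "norm e" 1] by simp
  have "(\<lambda>n. integral\<^sup>L lborel (q n)) \<longlonglongrightarrow> integral\<^sup>L lborel (\<lambda>x. f' x e)"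
  proof (rule integral_dominated_convergence)
    show "(\<lambda>x. f' x e) \<in> borel_measurable lborel" using borel_measurable_continuous_onI[OF cont] by simp
    show "q n \<in> borel_measurable lborel" for n unfolding q_def[abs_def] by measurable
    show "integrable lborel (\<lambda>x. B * indicator (cball 0 (R + 1)) x :: real)"
      by (intro integrable_mult_right) (auto intro!: emeasure_compact_finite borel_compact)
    show "AE x in lborel. (\<lambda>n. q n x) \<longlonglongrightarrow> f' x e"
    proof (rule AE_I2)
      fix x
      have "((\<lambda>s. (f (x + (0 + s) *\<^sub>R e) - f (x + 0 *\<^sub>R e)) / s) \<longlongrightarrow> f' (x + 0 *\<^sub>R e) e) (at 0)"
        using line[of x 0] unfolding DERIV_def .
      then have *: "((\<lambda>s. (f (x + s *\<^sub>R e) - f x) / s) \<longlongrightarrow> f' x e) (at 0)" by simp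
      show "(\<lambda>n. q n x) \<longlonglongrightarrow> f' x e"
        unfolding q_def
      proof (rule filterlim_compose[OF *])
        have "t n \<noteq> 0" for n using t(1)[of n] by simp
        then show "filterlim t (at 0) sequentially" by (simp add: filterlim_at t0)
      qed
    qed
    show "AE x in lborel. norm (q n x) \<le> B * indicator (cball 0 (R + 1)) x" for n
    proof (rule AE_I2)
      fix x
      show "norm (q n x) \<le> B * indicator (cball 0 (R + 1)) x"
      proof (cases "norm x \<le> R + 1")
        case False
        have "norm x \<le> norm (x + t n *\<^sub>R e) + norm (t n *\<^sub>R e)"
          using norm_triangle_ineq4[of "x + t n *\<^sub>R e" "t n *\<^sub>R e"] by simp
        then have "norm (x + t n *\<^sub>R e) > R" using te[of "t n"] t[of n] False by linarith
        then have "q n x = 0" using f0[of x] f0[of "x + t n *\<^sub>R e"] False by (simp add: q_def)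
        then show ?thesis using B by simp
      next
        case True
        have "\<exists>s>0. s < t n \<and> f (x + t n *\<^sub>R e) - f (x + 0 *\<^sub>R e) = (t n - 0) * f' (x + s *\<^sub>R e) e"
          by (rule MVT2[OF t(1) line])
        then obtain s where s: "0 < s" "s < t n" "f (x + t n *\<^sub>R e) - f x = t n * f' (x + s *\<^sub>R e) e" by auto
        then have q: "q n x = f' (x + s *\<^sub>R e) e" using t[of n] by (simp add: q_def)
        have "\<bar>f' (x + s *\<^sub>R e) e\<bar> \<le> B"
        proof (cases "norm (x + s *\<^sub>R e) \<le> R + 1")
          case True then show ?thesis by (rule B)
        next
          case False
          have "(f has_derivative (\<lambda>h. 0)) (at (x + s *\<^sub>R e))"
          proof (rule has_derivative_transform_within_open[of "\<lambda>x. 0"])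
            show "open (- cball 0 R :: (real^3) set)" by (rule open_Compl[OF closed_cball])
          qed (use False f0 in auto)
          from has_derivative_unique[OF this deriv] have "f' (x + s *\<^sub>R e) e = 0" by metis
          then show ?thesis using B by simp
        qed
        with q True show ?thesis by simp
      qed
    qed
  qed
  moreover have "integral\<^sup>L lborel (q n) = 0" for n
  proof -
    have "integrable lborel (\<lambda>x. f (x + t n *\<^sub>R e))"
    proof (rule integrable_compact_support)
      show "continuous_on UNIV (\<lambda>x. f (x + t n *\<^sub>R e))"
        by (rule continuous_on_compose2[OF f_cont]) (auto intro!: continuous_intros)
      show "compact (cball 0 (R + 1) :: (real^3) set)" by simp
      fix x assume "x \<notin> cball (0 :: real^3) (R + 1)"
      moreover have "norm x \<le> norm (x + t n *\<^sub>R e) + norm (t n *\<^sub>R e)"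
        using norm_triangle_ineq4[of "x + t n *\<^sub>R e" "t n *\<^sub>R e"] by simp
      ultimately have "norm (x + t n *\<^sub>R e) > R" using te[of "t n"] t[of n] by simp
      then show "f (x + t n *\<^sub>R e) = 0" by (rule f0)
    qed
    then show ?thesis
      using f_int integral_lborel_translate[OF f_meas, of "t n *\<^sub>R e"] unfolding q_def[abs_def] by simp
  qed
  ultimately show ?thesis by (simp add: LIMSEQ_const_iff)
qed

lemma test_supportE:
  fixes \<phi> :: "real^3 \<Rightarrow> 'b::euclidean_space"
  assumes "\<phi> \<in> test_functions \<Omega>"
  obtains K where "compact K" "K \<subseteq> \<Omega>" "\<And>x. x \<notin> K \<Longrightarrow> \<phi> x = 0"
proof
  show "compact (closure {x. \<phi> x \<noteq> 0})" "closure {x. \<phi> x \<noteq> 0} \<subseteq> \<Omega>"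
    using assms by (auto simp: test_functions_def)
  show "\<phi> x = 0" if "x \<notin> closure {x. \<phi> x \<noteq> 0}" for x
    using that closure_subset[of "{x. \<phi> x \<noteq> 0}"] by auto
qed

lemma test_L2:
  fixes \<phi> :: "real^3 \<Rightarrow> 'b::euclidean_space"
  assumes \<phi>: "\<phi> \<in> test_functions \<Omega>" and \<Omega>: "\<Omega> \<in> sets lebesgue"
  shows "\<phi> \<in> L2 \<Omega>"
proof -
  obtain K where K: "compact K" "K \<subseteq> \<Omega>" "\<And>x. x \<notin> K \<Longrightarrow> \<phi> x = 0" using test_supportE[OF \<phi>] by blast
  have c: "continuous_on UNIV (\<lambda>x. (norm (\<phi> x))\<^sup>2)" by (intro continuous_intros test_continuous[OF \<phi>])
  have "integrable (lebesgue_on \<Omega>) (\<lambda>x. (norm (\<phi> x))\<^sup>2)"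
    by (rule lebesgue_on_compact_support(1)[OF c K(1) _ K(2) \<Omega>]) (simp add: K(3))
  moreover have "\<phi> \<in> borel_measurable (lebesgue_on \<Omega>)"
    using borel_measurable_continuous_onI[OF test_continuous[OF \<phi>]]
    by (intro measurable_restrict_space1 measurable_completion) simp
  ultimately show ?thesis by (simp add: L2_def)
qed

lemma test_by_parts:
  fixes \<phi> \<psi> :: "real^3 \<Rightarrow> real"
  assumes \<phi>: "\<phi> \<in> test_functions \<Omega>" and \<psi>: "\<psi> \<in> test_functions \<Omega>" and \<Omega>: "\<Omega> \<in> sets lebesgue"
  shows "L2inner \<Omega> \<phi> (partial i \<psi>) = - L2inner \<Omega> (partial i \<phi>) \<psi>"
proof -
  obtain K where K: "compact K" "K \<subseteq> \<Omega>" "\<And>x. x \<notin> K \<Longrightarrow> \<phi> x = 0" using test_supportE[OF \<phi>] by blast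
  have c: "continuous_on UNIV (\<lambda>x. \<phi> x * partial i \<psi> x + partial i \<phi> x * \<psi> x)"
    by (intro continuous_intros test_continuous[OF \<phi>] test_continuous[OF \<psi>]
        test_continuous[OF test_partial[OF \<phi>]] test_continuous[OF test_partial[OF \<psi>]])
  obtain K' where K': "compact K'" "K' \<subseteq> \<Omega>" "\<And>x. x \<notin> K' \<Longrightarrow> \<psi> x = 0" using test_supportE[OF \<psi>] by blast
  have L: "\<phi> \<in> L2 \<Omega>" "\<psi> \<in> L2 \<Omega>" "partial i \<phi> \<in> L2 \<Omega>" "partial i \<psi> \<in> L2 \<Omega>"
    using \<phi> \<psi> \<Omega> by (auto intro: test_L2 test_partial)
  have "L2inner \<Omega> \<phi> (partial i \<psi>) + L2inner \<Omega> (partial i \<phi>) \<psi>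
      = (LINT x|lebesgue_on \<Omega>. \<phi> x * partial i \<psi> x + partial i \<phi> x * \<psi> x)"
    using L2_inner_integrable[OF L(1,4)] L2_inner_integrable[OF L(3,2)] by (simp add: L2inner_def)
  also have "\<dots> = (LINT x|lborel. \<phi> x * partial i \<psi> x + partial i \<phi> x * \<psi> x)"
    by (rule lebesgue_on_compact_support(2)[OF c compact_Un[OF K(1) K'(1)] _ _ \<Omega>]) (use K K' in auto)
  also have "\<dots> = 0"
    unfolding partial_def
  proof (rule integral_directional_derivative_zero)
    show "((\<lambda>x. \<phi> x * \<psi> x) has_derivative
        (\<lambda>h. \<phi> x * frechet_derivative \<psi> (at x) h + frechet_derivative \<phi> (at x) h * \<psi> x)) (at x)" for x
      by (rule has_derivative_mult[OF test_has_derivative[OF \<phi>] test_has_derivative[OF \<psi>]])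
    show "continuous_on UNIV (\<lambda>x. \<phi> x * frechet_derivative \<psi> (at x) (axis i 1)
        + frechet_derivative \<phi> (at x) (axis i 1) * \<psi> x)"
      using c by (simp add: partial_def)
    show "compact K" by (rule K)
  qed (use K in \<open>auto simp: norm_axis_1\<close>)
  finally show ?thesis by simp
qed

text \<open>
  Integrating \<open>\<phi>\<^sup>2 = \<partial>\<^sub>i (x\<^sub>i) \<phi>\<^sup>2\<close> by parts gives
  \<open>\<parallel>\<phi>\<parallel>\<^sup>2 = - 2 \<integral> x\<^sub>i \<phi> \<partial>\<^sub>i \<phi>\<close>, and the Cauchy-Schwarz inequality bounds the right-hand side
  by \<open>2 R \<parallel>\<phi>\<parallel> \<parallel>\<partial>\<^sub>i \<phi>\<parallel>\<close>.
\<close>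

lemma test_Poincare:
  fixes \<phi> :: "real^3 \<Rightarrow> real"
  assumes \<phi>: "\<phi> \<in> test_functions \<Omega>" and \<Omega>: "\<Omega> \<in> sets lebesgue"
    and R: "R \<ge> 0" "\<And>x. x \<in> \<Omega> \<Longrightarrow> norm x \<le> R"
  shows "L2norm \<Omega> \<phi> \<le> 2 * R * L2norm \<Omega> (partial i \<phi>)"
proof -
  \<comment> \<open>\<open>\<partial>\<^sub>i \<eta> = \<phi> + x\<^sub>i \<partial>\<^sub>i \<phi>\<close>, so testing \<open>\<partial>\<^sub>i \<eta>\<close> with \<open>\<phi>\<close> produces the norm of \<open>\<phi>\<close>.\<close>
  define \<eta> where "\<eta> x = x $ i * \<phi> x" for x
  have \<eta>: "\<eta> \<in> test_functions \<Omega>"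
  proof (rule test_subsupport[OF \<phi>])
    have "Ck k (\<lambda>x::real^3. x)" for k
    proof (cases k)
      case (Suc j)
      show ?thesis unfolding Suc by (rule Ck_SucI[of _ "\<lambda>x h. h"]) (auto intro: Ck_const)
    qed simp
    then show "Ck k \<eta>" for k
      unfolding \<eta>_def[abs_def] by (intro Ck_mult test_Ck[OF \<phi>] Ck_bounded_linear[OF bounded_linear_vec_nth])
    show "\<eta> x = 0" if "x \<notin> closure {x. \<phi> x \<noteq> 0}" for x
      using that closure_subset[of "{x. \<phi> x \<noteq> 0}"] by (auto simp: \<eta>_def)
  qed
  have L: "\<phi> \<in> L2 \<Omega>" "\<eta> \<in> L2 \<Omega>" "partial i \<phi> \<in> L2 \<Omega>" "partial i \<eta> \<in> L2 \<Omega>"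
    using \<phi> \<eta> \<Omega> by (auto intro: test_L2 test_partial)
  have d\<eta>: "partial i \<eta> x = \<phi> x + x $ i * partial i \<phi> x" for x
  proof -
    have "((\<lambda>x. x $ i * \<phi> x) has_derivative (\<lambda>h. x $ i * frechet_derivative \<phi> (at x) h + h $ i * \<phi> x)) (at x)"
      by (rule has_derivative_mult[OF bounded_linear.has_derivative[OF bounded_linear_vec_nth has_derivative_ident] test_has_derivative[OF \<phi>]])
    from fun_cong[OF frechet_derivative_at[OF this, symmetric], of "axis i 1"]
    show ?thesis by (simp add: partial_def \<eta>_def[abs_def])
  qed
  have "L2inner \<Omega> (partial i \<eta>) \<phi> = (L2norm \<Omega> \<phi>)\<^sup>2 + L2inner \<Omega> \<eta> (partial i \<phi>)"
  proof -
    have "L2inner \<Omega> (partial i \<eta>) \<phi> = (LINT x|lebesgue_on \<Omega>. \<phi> x \<bullet> \<phi> x + \<eta> x \<bullet> partial i \<phi> x)"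
      unfolding L2inner_def by (simp add: d\<eta> \<eta>_def algebra_simps)
    also have "\<dots> = L2inner \<Omega> \<phi> \<phi> + L2inner \<Omega> \<eta> (partial i \<phi>)"
      unfolding L2inner_def by (intro Bochner_Integration.integral_add L2_inner_integrable L)
    finally show ?thesis by (simp add: L2norm_sq)
  qed
  moreover have "L2inner \<Omega> \<eta> (partial i \<phi>) = - L2inner \<Omega> (partial i \<eta>) \<phi>"
    by (rule test_by_parts[OF \<eta> \<phi> \<Omega>])
  ultimately have "(L2norm \<Omega> \<phi>)\<^sup>2 = - 2 * L2inner \<Omega> \<eta> (partial i \<phi>)" by simp
  also have "\<dots> \<le> 2 * (L2norm \<Omega> \<eta> * L2norm \<Omega> (partial i \<phi>))"
    using L2_Cauchy_Schwarz[OF L(2,3)] by simp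
  also have "\<dots> \<le> 2 * ((R * L2norm \<Omega> \<phi>) * L2norm \<Omega> (partial i \<phi>))"
  proof -
    have "L2norm \<Omega> \<eta> \<le> L2norm \<Omega> (\<lambda>x. R *\<^sub>R \<phi> x)"
    proof (rule L2norm_mono[OF L2_scaleR[OF L(1)] L(2) _ \<Omega>])
      fix x assume "x \<in> \<Omega>"
      then have "\<bar>x $ i\<bar> \<le> R" using component_le_norm_cart[of x i] R(2)[of x] by simp
      then show "norm (\<eta> x) \<le> norm (R *\<^sub>R \<phi> x)" using R(1) by (auto simp: \<eta>_def abs_mult intro: mult_right_mono)
    qed
    also have "\<dots> = R * L2norm \<Omega> \<phi>" using R(1) by (simp add: L2norm_def power_mult_distrib real_sqrt_mult)
    finally show ?thesis by (intro mult_left_mono mult_right_mono) (auto simp: L2norm_nonneg)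
  qed
  finally have "L2norm \<Omega> \<phi> * L2norm \<Omega> \<phi> \<le> L2norm \<Omega> \<phi> * (2 * R * L2norm \<Omega> (partial i \<phi>))"
    by (simp add: power2_eq_square mult_ac)
  then show ?thesis
    using L2norm_nonneg[of \<Omega> \<phi>] L2norm_nonneg[of \<Omega> "partial i \<phi>"] R(1)
    by (cases "L2norm \<Omega> \<phi> = 0") (auto simp: mult_le_cancel_left)
qed

section \<open>Smooth bumps and the fundamental lemma\<close>

text \<open>
  The functions \<open>exp (- 1 / t) / t ^ n\<close>, extended by zero to \<open>t \<le> 0\<close>. The family is closed under
  differentiation up to linear combinations, which makes all its members smooth.
\<close>

definition flat :: "nat \<Rightarrow> real \<Rightarrow> real" where
  "flat n t = (if t > 0 then inverse t ^ n * exp (- inverse t) else 0)"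

lemma flat_over_tendsto_0: "((\<lambda>h. flat n h / h) \<longlongrightarrow> 0) (at 0)"
  unfolding filterlim_at_split
proof
  have "\<forall>\<^sub>F h in at_left 0. 0 = flat n h / h"
    by (rule eventually_at_leftI[of "-1"]) (auto simp: flat_def)
  then show "((\<lambda>h. flat n h / h) \<longlongrightarrow> 0) (at_left 0)"
    by (rule Lim_transform_eventually[OF tendsto_const])
  have "((\<lambda>h::real. inverse h ^ Suc n / exp (inverse h)) \<longlongrightarrow> 0) (at_right 0)"
    by (rule filterlim_compose[OF tendsto_power_div_exp_0 filterlim_inverse_at_top_right])
  moreover have "\<forall>\<^sub>F h in at_right 0. inverse h ^ Suc n / exp (inverse h) = flat n h / h"
    by (rule eventually_at_rightI[of _ 1]) (auto simp: flat_def exp_minus field_simps)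
  ultimately show "((\<lambda>h. flat n h / h) \<longlongrightarrow> 0) (at_right 0)"
    by (rule Lim_transform_eventually)
qed

lemma flat_has_derivative:
  "(flat n has_real_derivative flat (n + 2) t - n * flat (n + 1) t) (at t)"
proof (cases t "0 :: real" rule: linorder_cases)
  case less
  have "((\<lambda>t. 0) has_real_derivative 0) (at t)" by simp
  moreover have "open {..<0::real}" by simp
  ultimately have "(flat n has_real_derivative 0) (at t)"
    by (rule has_field_derivative_transform_within_open) (use less in \<open>auto simp: flat_def\<close>)
  then show ?thesis using less by (simp add: flat_def)
next
  case equal
  have "(flat n has_real_derivative 0) (at 0)"
    unfolding DERIV_def using flat_over_tendsto_0[of n] by (simp add: flat_def[of n 0])
  then show ?thesis using equal by (simp add: flat_def)
next
  case greater
  have "((\<lambda>t. inverse t ^ n * exp (- inverse t)) has_real_derivative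
      inverse t ^ n * (exp (- inverse t) * (inverse t * inverse t))
      + (real n * (- (inverse t * inverse t) * inverse t ^ (n - 1))) * exp (- inverse t)) (at t)"
    using greater by (auto intro!: derivative_eq_intros simp: power2_eq_square)
  also have "inverse t ^ n * (exp (- inverse t) * (inverse t * inverse t))
      + (real n * (- (inverse t * inverse t) * inverse t ^ (n - 1))) * exp (- inverse t)
      = flat (n + 2) t - n * flat (n + 1) t"
    using greater by (cases n) (auto simp: flat_def algebra_simps)
  finally have *: "((\<lambda>t. inverse t ^ n * exp (- inverse t)) has_real_derivative
    flat (n + 2) t - n * flat (n + 1) t) (at t)" .
  moreover have "open {0::real<..}" by simp
  ultimately show ?thesis
    by (rule has_field_derivative_transform_within_open) (use greater in \<open>auto simp: flat_def\<close>)
qed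

lemma Ck_flat_affine:
  assumes l: "bounded_linear l"
  shows "Ck k (\<lambda>x. flat n (l x + c))"
proof (induction k arbitrary: n)
  have deriv: "((\<lambda>x. flat n (l x + c)) has_derivative
      (\<lambda>h. l h * (flat (n + 2) (l x + c) - n * flat (n + 1) (l x + c)))) (at x)" for x n
  proof -
    have "((\<lambda>x. l x + c) has_derivative l) (at x)"
      by (rule has_derivative_eq_rhs[OF has_derivative_add[OF bounded_linear_imp_has_derivative[OF l] has_derivative_const]]) simp
    from has_derivative_compose[OF this flat_has_derivative[unfolded has_field_derivative_def]]
    show ?thesis by (simp add: mult.commute)
  qed
  case 0
  show ?case
    using has_derivative_continuous[OF deriv] by (auto intro: continuous_at_imp_continuous_on)
  case (Suc k)
  show ?case
  proof (rule Ck_SucI[OF deriv])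
    fix h
    have "Ck k (\<lambda>x. l h *\<^sub>R (flat (n + 2) (l x + c) + (- real n) *\<^sub>R flat (n + 1) (l x + c)))"
      by (rule Ck_bounded_linear[OF bounded_linear_scaleR_right
            Ck_add[OF Suc Ck_bounded_linear[OF bounded_linear_scaleR_right Suc]]])
    then show "Ck k (\<lambda>x. l h * (flat (n + 2) (l x + c) - real n * flat (n + 1) (l x + c)))" by simp
  qed
qed

text \<open>
  Since \<open>flat 0 (m * s) = exp (- 1 / (m * s))\<close>, increasing \<open>m\<close> amounts to taking the \<open>m\<close>-th root of
  a function that is positive exactly on the box. So the bumps tend to the indicator of the box without
  any normalization, and they are bounded by 1.
\<close>

definition bump :: "real^3 \<Rightarrow> real^3 \<Rightarrow> real \<Rightarrow> real^3 \<Rightarrow> real" where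
  "bump a b m x = (\<Prod>i\<in>UNIV. flat 0 (m * (x $ i - a $ i)) * flat 0 (m * (b $ i - x $ i)))"

lemma bump_Ck: "Ck k (bump a b m)"
proof -
  have "Ck k (\<lambda>x. flat 0 (m * (x $ i) + m * (- (a $ i))))" "Ck k (\<lambda>x. flat 0 ((- m) * (x $ i) + m * b $ i))" for i
    by (intro Ck_flat_affine bounded_linear_const_mult bounded_linear_vec_nth)+
  then show ?thesis
    unfolding bump_def[abs_def] by (intro Ck_prod Ck_mult) (auto simp: algebra_simps)
qed

lemma flat_0_bounds: "0 \<le> flat 0 t" "flat 0 t \<le> 1"
  by (auto simp: flat_def)

lemma bump_bounds: "0 \<le> bump a b m x" "bump a b m x \<le> 1"
  unfolding bump_def
  by (auto intro!: prod_nonneg prod_le_1 mult_nonneg_nonneg mult_le_one flat_0_bounds)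

lemma bump_outside: "x \<notin> box a b \<Longrightarrow> m > 0 \<Longrightarrow> bump a b m x = 0"
  unfolding bump_def by (force simp: mem_box_cart flat_def zero_less_mult_iff)

lemma bump_tendsto_indicator:
  "(\<lambda>n. bump a b (real (Suc n)) x) \<longlonglongrightarrow> indicator (box a b) x"
proof (cases "x \<in> box a b")
  case False
  then show ?thesis using bump_outside[OF False] by simp
next
  case True
  have lim: "(\<lambda>n. flat 0 (real (Suc n) * s)) \<longlonglongrightarrow> 1" if "s > 0" for s
  proof -
    have "(\<lambda>n. exp (- (inverse (real (Suc n)) * inverse s))) \<longlonglongrightarrow> exp (- (0 * inverse s))"
      by (intro tendsto_intros LIMSEQ_inverse_real_of_nat)
    moreover have "flat 0 (real (Suc n) * s) = exp (- (inverse (real (Suc n)) * inverse s))" for n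
      using that by (simp add: flat_def del: of_nat_Suc)
    ultimately show ?thesis by simp
  qed
  have "(\<lambda>n. bump a b (real (Suc n)) x) \<longlonglongrightarrow> (\<Prod>i\<in>(UNIV::3 set). 1 * 1)"
    unfolding bump_def using True by (intro tendsto_prod tendsto_mult lim) (auto simp: mem_box_cart)
  then show ?thesis using True by simp
qed

lemma bump_test:
  assumes "cbox a b \<subseteq> \<Omega>" "m > 0"
  shows "bump a b m \<in> test_functions \<Omega>"
proof -
  have "closure {x. bump a b m x \<noteq> 0} \<subseteq> cbox a b"
    using bump_outside[OF _ assms(2)] box_subset_cbox by (intro closure_minimal) blast+
  then show ?thesis
    using bump_Ck assms(1) compact_closure_subset[OF _ compact_cbox] by (auto simp: test_functions_def)
qed

text \<open>
  Boxes form an intersection-stable generator of the Borel sets, and the sets over which \<open>h\<close> has integral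
  zero form a Dynkin system.
\<close>

lemma AE_zero_if_box_integrals_zero:
  fixes h :: "real^3 \<Rightarrow> real"
  assumes h: "integrable lebesgue h"
    and box: "\<And>a b. set_lebesgue_integral lebesgue (box a b) h = 0"
  shows "AE x in lebesgue. h x = 0"
proof (rule density_unique_real[OF h integrable_zero])
  have sint: "set_integrable lebesgue A h" if "A \<in> sets lebesgue" for A
    unfolding set_integrable_def by (rule integrable_mult_indicator[OF that h])
  have total: "set_lebesgue_integral lebesgue UNIV h = 0"
  proof -
    let ?A = "\<lambda>n::nat. box (- (real n *\<^sub>R One)) (real n *\<^sub>R One) :: (real^3) set"
    have "(\<lambda>n. set_lebesgue_integral lebesgue (?A n) h) \<longlonglongrightarrow> set_lebesgue_integral lebesgue (\<Union>n. ?A n) h"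
    proof (rule set_integral_cont_up)
      show "incseq ?A" by (auto simp: incseq_def mem_box algebra_simps) (meson less_le_trans le_less_trans of_nat_mono neg_le_iff_le)+
    qed (auto intro: sint)
    then show ?thesis by (simp add: box UN_box_eq_UNIV LIMSEQ_const_iff)
  qed
  have borel: "set_lebesgue_integral lebesgue A h = 0" if "A \<in> sets borel" for A
  proof -
    have sets: "sigma_sets UNIV (range (\<lambda>(a, b). box a b :: (real^3) set)) = sets borel"
      by (simp add: borel_eq_box)
    have "Int_stable (range (\<lambda>(a, b). box a b :: (real^3) set))"
      by (auto simp: Int_stable_def box_Int_box)
    moreover have "range (\<lambda>(a, b). box a b :: (real^3) set) \<subseteq> Pow UNIV" by simp
    moreover have "A \<in> sigma_sets UNIV (range (\<lambda>(a, b). box a b))" using that by (simp add: sets)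
    ultimately show ?thesis
    proof (induction rule: sigma_sets_induct_disjoint)
      case (basic A) then show ?case using box by auto
    next
      case empty show ?case by (simp add: set_lebesgue_integral_def)
    next
      case (compl A)
      then have A: "A \<in> sets lebesgue" by (simp add: sets)
      have "set_lebesgue_integral lebesgue (A \<union> (UNIV - A)) h
          = set_lebesgue_integral lebesgue A h + set_lebesgue_integral lebesgue (UNIV - A) h"
        using A by (intro set_integral_Un sint) auto
      then show ?case using total compl by simp
    next
      case (union A)
      then have A: "A i \<in> sets lebesgue" for i by (auto simp: sets)
      have "set_lebesgue_integral lebesgue (\<Union>i. A i) h = (\<Sum>i. set_lebesgue_integral lebesgue (A i) h)"
        using union A by (intro lebesgue_integral_countable_add sint) (auto simp: disjoint_family_on_def)
      then show ?case using union by simp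
    qed
  qed
  fix A :: "(real^3) set" assume A: "A \<in> sets lebesgue"
  then obtain S N N' where SN: "A = S \<union> N" "N \<subseteq> N'" "N' \<in> null_sets lborel" "S \<in> sets lborel"
    by (elim sets_completionE)
  have "N' \<in> null_sets lebesgue" using SN(3) by (simp add: null_sets_completionI)
  then have "AE x in lebesgue. x \<notin> N'" by (rule AE_not_in)
  then have "AE x in lebesgue. indicat_real A x *\<^sub>R h x = indicat_real S x *\<^sub>R h x"
    by eventually_elim (use SN in \<open>auto simp: indicator_def\<close>)
  moreover have "S \<in> sets lebesgue" using SN(4) by simp
  ultimately have "set_lebesgue_integral lebesgue A h = set_lebesgue_integral lebesgue S h"
    unfolding set_lebesgue_integral_def
    using sint[OF A] sint[of S] by (intro integral_cong_AE) (auto simp: set_integrable_def)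
  then show "set_lebesgue_integral lebesgue A h = set_lebesgue_integral lebesgue A (\<lambda>x. 0)"
    using borel SN(4) by (simp add: set_lebesgue_integral_def)
qed

lemma indicator_L2:
  assumes "\<Omega> \<in> sets lebesgue" "A \<in> lmeasurable"
  shows "(\<lambda>x. indicator A x *\<^sub>R e) \<in> L2 \<Omega>"
proof -
  have "integrable lebesgue (indicat_real A)"
    using assms(2) by (intro integrable_real_indicator) (auto simp: fmeasurable_def)
  from integrable_mult_indicator[OF assms(1) this]
  have "integrable (lebesgue_on \<Omega>) (indicat_real A)"
    using assms(1) by (simp add: integrable_restrict_space)
  then have "integrable (lebesgue_on \<Omega>) (\<lambda>x. (norm e)\<^sup>2 * indicat_real A x)" by simp
  also have "(\<lambda>x. (norm e)\<^sup>2 * indicat_real A x) = (\<lambda>x. (norm (indicator A x *\<^sub>R e))\<^sup>2)"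
    by (auto simp: indicator_def fun_eq_iff)
  finally show ?thesis
    unfolding L2_def using assms(2) by (auto intro!: measurable_restrict_space1 borel_measurable_scaleR)
qed

text \<open>
  The fundamental lemma of the calculus of variations. Testing with bumps times a basis vector, the limit
  shows that each component of \<open>f\<close> has integral zero over all boxes whose closure lies in \<open>\<Omega>\<close>. Countably
  many such boxes cover \<open>\<Omega>\<close>.
\<close>

lemma L2_AE_zero_if_orthogonal_to_tests:
  fixes f :: "real^3 \<Rightarrow> 'b::euclidean_space"
  assumes \<Omega>: "open \<Omega>" and f: "f \<in> L2 \<Omega>"
    and orth: "\<And>\<phi>. \<phi> \<in> test_functions \<Omega> \<Longrightarrow> L2inner \<Omega> f \<phi> = 0"
  shows "AE x in lebesgue_on \<Omega>. f x = 0"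
proof -
  have \<Omega>_m: "\<Omega> \<in> sets lebesgue" using \<Omega> by simp
  have box0: "(LINT x|lebesgue_on \<Omega>. indicator (box a b) x * (f x \<bullet> e)) = 0"
    if ab: "cbox a b \<subseteq> \<Omega>" for a b e
  proof -
    have ind: "(\<lambda>x. indicator (cbox a b) x *\<^sub>R e) \<in> L2 \<Omega>"
      by (rule indicator_L2[OF \<Omega>_m lmeasurable_cbox])
    have dom: "integrable (lebesgue_on \<Omega>) (\<lambda>x. f x \<bullet> (indicator (cbox a b) x *\<^sub>R e))"
      by (rule L2_inner_integrable[OF f ind])
    have [measurable]: "f \<in> borel_measurable (lebesgue_on \<Omega>)" by (rule L2_measurable[OF f])
    have bm: "bump a b m \<in> borel_measurable (lebesgue_on \<Omega>)" for m
      using borel_measurable_continuous_onI[of "bump a b m"] bump_Ck[of 0 a b m]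
      by (intro measurable_restrict_space1 measurable_completion) simp
    have "(\<lambda>n. LINT x|lebesgue_on \<Omega>. bump a b (real (Suc n)) x * (f x \<bullet> e))
        \<longlonglongrightarrow> (LINT x|lebesgue_on \<Omega>. indicator (box a b) x * (f x \<bullet> e))"
    proof (rule integral_dominated_convergence)
      show "integrable (lebesgue_on \<Omega>) (\<lambda>x. norm (f x \<bullet> (indicator (cbox a b) x *\<^sub>R e)))"
        using dom by (rule integrable_norm)
      show "AE x in lebesgue_on \<Omega>. (\<lambda>n. bump a b (real (Suc n)) x * (f x \<bullet> e)) \<longlonglongrightarrow> indicator (box a b) x * (f x \<bullet> e)"
        by (intro AE_I2 tendsto_mult bump_tendsto_indicator tendsto_const)
      show "AE x in lebesgue_on \<Omega>. norm (bump a b (real (Suc n)) x * (f x \<bullet> e))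
          \<le> norm (f x \<bullet> (indicator (cbox a b) x *\<^sub>R e))" for n
      proof (rule AE_I2)
        fix x
        show "norm (bump a b (real (Suc n)) x * (f x \<bullet> e)) \<le> norm (f x \<bullet> (indicator (cbox a b) x *\<^sub>R e))"
        proof (cases "x \<in> cbox a b")
          case True
          then show ?thesis using bump_bounds[of a b "real (Suc n)" x]
            by (simp add: abs_mult mult_left_le_one_le del: of_nat_Suc)
        next
          case False
          then have "x \<notin> box a b" using box_subset_cbox by blast
          then show ?thesis using False bump_outside[of x a b "real (Suc n)"] by simp
        qed
      qed
      show "(\<lambda>x. bump a b (real (Suc n)) x * (f x \<bullet> e)) \<in> borel_measurable (lebesgue_on \<Omega>)" for n
        using bm by measurable
      show "(\<lambda>x. indicator (box a b) x * (f x \<bullet> e)) \<in> borel_measurable (lebesgue_on \<Omega>)"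
      proof -
        have "indicat_real (box a b) \<in> borel_measurable (lebesgue_on \<Omega>)"
          by (intro measurable_restrict_space1 measurable_completion) simp
        then show ?thesis by measurable
      qed
    qed
    moreover have "(LINT x|lebesgue_on \<Omega>. bump a b (real (Suc n)) x * (f x \<bullet> e)) = 0" for n
    proof -
      have "(\<lambda>x. bump a b (real (Suc n)) x *\<^sub>R e) \<in> test_functions \<Omega>"
        by (rule test_bounded_linear[OF bounded_linear_scaleR_left bump_test[OF ab]]) simp
      from orth[OF this] show ?thesis by (simp add: L2inner_def)
    qed
    ultimately show ?thesis by (simp add: LIMSEQ_const_iff)
  qed
  have local: "AE x in lebesgue. x \<in> box a b \<longrightarrow> f x \<bullet> e = 0" if ab: "cbox a b \<subseteq> \<Omega>" for a b e
  proof -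
    define h where "h x = indicat_real \<Omega> x * (indicator (box a b) x * (f x \<bullet> e))" for x
    have sub: "box a b \<subseteq> \<Omega>" using ab box_subset_cbox by blast
    have int: "integrable lebesgue h"
    proof -
      have "(\<lambda>x. indicator (box a b) x *\<^sub>R e) \<in> L2 \<Omega>"
        by (rule indicator_L2[OF \<Omega>_m lmeasurable_box])
      from L2_inner_integrable[OF f this]
      show ?thesis using \<Omega>_m by (simp add: integrable_restrict_space h_def[abs_def])
    qed
    have "AE x in lebesgue. h x = 0"
    proof (rule AE_zero_if_box_integrals_zero[OF int])
      fix c d :: "real^3"
      obtain a' b' where ab': "box a b \<inter> box c d = box a' b'" "cbox a b \<inter> cbox c d = cbox a' b'"
        by (rule that[OF box_Int_box Int_interval])
      have "set_lebesgue_integral lebesgue (box c d) h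
          = integral\<^sup>L lebesgue (\<lambda>x. indicat_real \<Omega> x * (indicator (box a' b') x * (f x \<bullet> e)))"
        unfolding set_lebesgue_integral_def h_def ab'(1)[symmetric]
        by (rule Bochner_Integration.integral_cong) (auto simp: indicator_def)
      also have "\<dots> = (LINT x|lebesgue_on \<Omega>. indicator (box a' b') x * (f x \<bullet> e))"
        using \<Omega>_m by (simp add: integral_restrict_space)
      also have "\<dots> = 0" using ab'(2) ab by (intro box0) blast
      finally show "set_lebesgue_integral lebesgue (box c d) h = 0" .
    qed
    then show ?thesis by eventually_elim (use sub in \<open>auto simp: h_def indicator_def split: if_splits\<close>)
  qed
  define F where "F = {box a b |a b. cbox a b \<subseteq> \<Omega>}"
  obtain F' where F': "F' \<subseteq> F" "countable F'" "\<Union>F' = \<Union>F"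
    by (rule Lindelof[of F]) (auto simp: F_def)
  have "\<Union>F = \<Omega>"
  proof
    show "\<Union>F \<subseteq> \<Omega>" using box_subset_cbox by (fastforce simp: F_def)
    show "\<Omega> \<subseteq> \<Union>F"
    proof
      fix x assume "x \<in> \<Omega>"
      obtain a b where "cbox a b \<subseteq> \<Omega>" "x \<in> box a b"
        by (rule open_contains_cbox[OF \<Omega> \<open>x \<in> \<Omega>\<close>])
      then show "x \<in> \<Union>F" by (auto simp: F_def)
    qed
  qed
  have "AE x in lebesgue. \<forall>e\<in>Basis. \<forall>B\<in>F'. x \<in> B \<longrightarrow> f x \<bullet> e = 0"
  proof (rule AE_finite_allI[OF finite_Basis])
    fix e :: 'b
    show "AE x in lebesgue. \<forall>B\<in>F'. x \<in> B \<longrightarrow> f x \<bullet> e = 0"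
      unfolding AE_ball_countable[OF F'(2)]
    proof
      fix B assume "B \<in> F'"
      with F'(1) obtain a b where "B = box a b" "cbox a b \<subseteq> \<Omega>" by (auto simp: F_def)
      then show "AE x in lebesgue. x \<in> B \<longrightarrow> f x \<bullet> e = 0" using local by simp
    qed
  qed
  then have "AE x in lebesgue. x \<in> \<Omega> \<longrightarrow> f x = 0"
  proof eventually_elim
    case (elim x)
    show ?case
    proof
      assume "x \<in> \<Omega>"
      then have "\<forall>e\<in>Basis. f x \<bullet> e = 0" using elim F'(3) \<open>\<Union>F = \<Omega>\<close> by blast
      then show "f x = 0" by (auto intro: euclidean_eqI)
    qed
  qed
  then show ?thesis using \<Omega>_m by (simp add: AE_restrict_space_iff)
qed

section \<open>Weak derivatives\<close>

text \<open>
  The common form of the three weak derivatives: \<open>A\<close> is the formal adjoint, acting on test functions, of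
  the differential operator that takes \<open>u\<close> to \<open>g\<close>.
\<close>

definition weakly :: "(real^3) set \<Rightarrow> ((real^3 \<Rightarrow> 'b::euclidean_space) \<Rightarrow> real^3 \<Rightarrow> 'a::euclidean_space)
    \<Rightarrow> (real^3 \<Rightarrow> 'a) \<Rightarrow> (real^3 \<Rightarrow> 'b) \<Rightarrow> bool" where
  "weakly \<Omega> A u g \<longleftrightarrow> (\<forall>\<phi>\<in>test_functions \<Omega>. L2inner \<Omega> u (A \<phi>) = L2inner \<Omega> g \<phi>)"

lemma is_weak_grad_iff: "is_weak_grad \<Omega> u g \<longleftrightarrow> weakly \<Omega> (\<lambda>\<phi> x. - classical_div \<phi> x) u g"
  by (auto simp: is_weak_grad_def weakly_def L2inner_def)

lemma is_weak_curl_iff: "is_weak_curl \<Omega> w c \<longleftrightarrow> weakly \<Omega> classical_curl w c"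
  by (simp add: is_weak_curl_def weakly_def L2inner_def)

lemma is_weak_div_iff: "is_weak_div \<Omega> w d \<longleftrightarrow> weakly \<Omega> (\<lambda>\<phi> x. - classical_grad \<phi> x) w d"
  by (auto simp: is_weak_div_def weakly_def L2inner_def)

lemma weakly_unique:
  fixes A :: "(real^3 \<Rightarrow> 'b::euclidean_space) \<Rightarrow> real^3 \<Rightarrow> 'a::euclidean_space"
  assumes "open \<Omega>" "weakly \<Omega> A u g" "weakly \<Omega> A u g'" "g \<in> L2 \<Omega>" "g' \<in> L2 \<Omega>"
  shows "AE x in lebesgue_on \<Omega>. g x = g' x"
proof -
  have "AE x in lebesgue_on \<Omega>. g x - g' x = 0"
  proof (rule L2_AE_zero_if_orthogonal_to_tests[OF assms(1) L2_diff[OF assms(4,5)]])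
    fix \<phi> :: "real^3 \<Rightarrow> 'b" assume \<phi>: "\<phi> \<in> test_functions \<Omega>"
    then have "\<phi> \<in> L2 \<Omega>" using assms(1) by (intro test_L2) auto
    then show "L2inner \<Omega> (\<lambda>x. g x - g' x) \<phi> = 0"
      using assms(2-5) \<phi> by (simp add: L2inner_diff_left weakly_def)
  qed
  then show ?thesis by simp
qed

lemma weakly_diff:
  assumes "\<And>\<phi>. \<phi> \<in> test_functions \<Omega> \<Longrightarrow> A \<phi> \<in> L2 \<Omega>" "\<Omega> \<in> sets lebesgue"
    and "weakly \<Omega> A u g" "weakly \<Omega> A v h" "u \<in> L2 \<Omega>" "v \<in> L2 \<Omega>" "g \<in> L2 \<Omega>" "h \<in> L2 \<Omega>"
  shows "weakly \<Omega> A (\<lambda>x. u x - v x) (\<lambda>x. g x - h x)"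
  using assms by (simp add: weakly_def L2inner_diff_left test_L2)

lemma weakly_limit:
  fixes A :: "(real^3 \<Rightarrow> 'b::euclidean_space) \<Rightarrow> real^3 \<Rightarrow> 'a::euclidean_space"
  assumes "\<And>\<phi>. \<phi> \<in> test_functions \<Omega> \<Longrightarrow> A \<phi> \<in> L2 \<Omega>" "\<Omega> \<in> sets lebesgue"
    and wk: "\<And>k. weakly \<Omega> A (u k) (g k)" and L2: "\<And>k. u k \<in> L2 \<Omega>" "\<And>k. g k \<in> L2 \<Omega>" "v \<in> L2 \<Omega>" "h \<in> L2 \<Omega>"
    and lim: "(\<lambda>k. L2norm \<Omega> (\<lambda>x. u k x - v x)) \<longlonglongrightarrow> 0" "(\<lambda>k. L2norm \<Omega> (\<lambda>x. g k x - h x)) \<longlonglongrightarrow> 0"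
  shows "weakly \<Omega> A v h"
  unfolding weakly_def
proof
  fix \<phi> :: "real^3 \<Rightarrow> 'b" assume \<phi>: "\<phi> \<in> test_functions \<Omega>"
  have "(\<lambda>k. L2inner \<Omega> (u k) (A \<phi>)) \<longlonglongrightarrow> L2inner \<Omega> v (A \<phi>)"
    by (rule L2inner_tendsto[OF L2(1,3) assms(1)[OF \<phi>] lim(1)])
  moreover have "(\<lambda>k. L2inner \<Omega> (g k) \<phi>) \<longlonglongrightarrow> L2inner \<Omega> h \<phi>"
    by (rule L2inner_tendsto[OF L2(2,4) test_L2[OF \<phi> assms(2)] lim(2)])
  ultimately show "L2inner \<Omega> v (A \<phi>) = L2inner \<Omega> h \<phi>"
    using wk \<phi> by (simp add: weakly_def LIMSEQ_unique)
qed

section \<open>Gradient, divergence and curl of test functions\<close>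

lemma classical_grad_test: "\<phi> \<in> test_functions \<Omega> \<Longrightarrow> classical_grad \<phi> \<in> test_functions \<Omega>"
  unfolding classical_grad_def[abs_def] by (intro test_vec test_partial)

lemma classical_div_test: "\<phi> \<in> test_functions \<Omega> \<Longrightarrow> classical_div \<phi> \<in> test_functions \<Omega>"
  unfolding classical_div_def[abs_def] by (intro test_sum test_nth test_partial)

lemma test_minus: "\<phi> \<in> test_functions \<Omega> \<Longrightarrow> (\<lambda>x. - \<phi> x) \<in> test_functions \<Omega>"
  using test_scaleR[of \<phi> \<Omega> "-1"] by simp

lemma test_diff:
  "\<phi> \<in> test_functions \<Omega> \<Longrightarrow> \<psi> \<in> test_functions \<Omega> \<Longrightarrow> (\<lambda>x. \<phi> x - \<psi> x) \<in> test_functions \<Omega>"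
  using test_add[OF _ test_minus, of \<phi> \<Omega> \<psi>] by simp

lemma classical_curl_nth:
  "classical_curl \<phi> x $ 1 = partial 2 \<phi> x $ 3 - partial 3 \<phi> x $ 2"
  "classical_curl \<phi> x $ 2 = partial 3 \<phi> x $ 1 - partial 1 \<phi> x $ 3"
  "classical_curl \<phi> x $ 3 = partial 1 \<phi> x $ 2 - partial 2 \<phi> x $ 1"
  by (simp_all add: classical_curl_def)

lemma classical_curl_test:
  assumes "\<phi> \<in> test_functions \<Omega>" shows "classical_curl \<phi> \<in> test_functions \<Omega>"
proof -
  have "(\<lambda>x. classical_curl \<phi> x $ i) \<in> test_functions \<Omega>" for i
    by (rule spec[where x = i])
      (auto simp: forall_3 classical_curl_nth intro!: test_diff test_nth test_partial assms)
  then have "(\<lambda>x. \<chi> i. classical_curl \<phi> x $ i) \<in> test_functions \<Omega>" by (rule test_vec)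
  then show ?thesis by simp
qed

lemma classical_div_curl:
  assumes "\<phi> \<in> test_functions \<Omega>" shows "classical_div (classical_curl \<phi>) x = 0"
proof -
  have d: "partial i (\<lambda>y. partial j \<phi> y $ k - partial j' \<phi> y $ k') x
      = partial i (partial j (\<lambda>y. \<phi> y $ k)) x - partial i (partial j' (\<lambda>y. \<phi> y $ k')) x" for i j j' k k'
  proof -
    have "(\<lambda>y. partial j \<phi> y $ k - partial j' \<phi> y $ k')
        = (\<lambda>y. partial j (\<lambda>z. \<phi> z $ k) y + (-1) *\<^sub>R partial j' (\<lambda>z. \<phi> z $ k') y)"
      using partial_nth[OF assms] by simp
    then show ?thesis
      using assms by (simp only: partial_add[OF test_partial[OF test_nth] test_scaleR[OF test_partial[OF test_nth]]]
        partial_scaleR[OF test_partial[OF test_nth]]) simp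
  qed
  have "classical_div (classical_curl \<phi>) x = (\<Sum>i\<in>UNIV. partial i (\<lambda>y. classical_curl \<phi> y $ i) x)"
    unfolding classical_div_def by (simp add: partial_nth[OF classical_curl_test[OF assms]])
  also have "\<dots> = 0"
    using partial_commute[OF test_nth[OF assms]]
    by (simp add: sum_3 classical_curl_nth d)
  finally show ?thesis .
qed

lemma L2inner_vec:
  fixes f g :: "real^3 \<Rightarrow> 'b::euclidean_space^3"
  assumes "f \<in> L2 \<Omega>" "g \<in> L2 \<Omega>"
  shows "L2inner \<Omega> f g = (\<Sum>i\<in>UNIV. L2inner \<Omega> (\<lambda>x. f x $ i) (\<lambda>x. g x $ i))"
  unfolding L2inner_def inner_vec_def
  by (intro Bochner_Integration.integral_sum L2_inner_integrable L2_nth assms)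

lemma test_weak_grad:
  assumes \<phi>: "\<phi> \<in> test_functions \<Omega>" and \<Omega>: "\<Omega> \<in> sets lebesgue"
  shows "is_weak_grad \<Omega> \<phi> (classical_grad \<phi>)"
  unfolding is_weak_grad_iff weakly_def
proof
  fix \<psi> :: "real^3 \<Rightarrow> real^3" assume \<psi>: "\<psi> \<in> test_functions \<Omega>"
  note T = test_L2[OF _ \<Omega>]
  have "L2inner \<Omega> \<phi> (\<lambda>x. - classical_div \<psi> x) = - (\<Sum>i\<in>UNIV. L2inner \<Omega> \<phi> (partial i (\<lambda>y. \<psi> y $ i)))"
  proof -
    have "L2inner \<Omega> \<phi> (classical_div \<psi>) = (\<Sum>i\<in>UNIV. L2inner \<Omega> \<phi> (partial i (\<lambda>y. \<psi> y $ i)))"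
      unfolding L2inner_def classical_div_def inner_sum_right partial_nth[OF \<psi>]
      by (intro Bochner_Integration.integral_sum L2_inner_integrable T \<phi> test_partial test_nth \<psi>)
    then show ?thesis by (simp add: L2inner_minus_right)
  qed
  also have "\<dots> = (\<Sum>i\<in>UNIV. L2inner \<Omega> (partial i \<phi>) (\<lambda>y. \<psi> y $ i))"
    by (simp add: test_by_parts[OF \<phi> test_nth[OF \<psi>] \<Omega>] sum_negf)
  also have "\<dots> = L2inner \<Omega> (classical_grad \<phi>) \<psi>"
    by (subst L2inner_vec) (auto simp: classical_grad_def intro!: T classical_grad_test \<phi> \<psi>)
  finally show "L2inner \<Omega> \<phi> (\<lambda>x. - classical_div \<psi> x) = L2inner \<Omega> (classical_grad \<phi>) \<psi>" .
qed

lemma test_weak_curl: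
  assumes \<phi>: "\<phi> \<in> test_functions \<Omega>" and \<Omega>: "\<Omega> \<in> sets lebesgue"
  shows "is_weak_curl \<Omega> \<phi> (classical_curl \<phi>)"
  unfolding is_weak_curl_iff weakly_def
proof
  fix \<psi> :: "real^3 \<Rightarrow> real^3" assume \<psi>: "\<psi> \<in> test_functions \<Omega>"
  note T = test_L2[OF _ \<Omega>]
  have t: "(\<lambda>x. \<phi> x $ i) \<in> L2 \<Omega>" "(\<lambda>x. \<psi> x $ i) \<in> L2 \<Omega>"
     "partial j (\<lambda>x. \<phi> x $ i) \<in> L2 \<Omega>" "partial j (\<lambda>x. \<psi> x $ i) \<in> L2 \<Omega>" for i j
    by (intro T test_partial test_nth \<phi> \<psi>)+
  have p: "L2inner \<Omega> (\<lambda>x. \<phi> x $ i) (partial j (\<lambda>x. \<psi> x $ k)) = - L2inner \<Omega> (partial j (\<lambda>x. \<phi> x $ i)) (\<lambda>x. \<psi> x $ k)" for i j k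
    by (rule test_by_parts[OF test_nth[OF \<phi>] test_nth[OF \<psi>] \<Omega>])
  show "L2inner \<Omega> \<phi> (classical_curl \<psi>) = L2inner \<Omega> (classical_curl \<phi>) \<psi>"
    by (subst (1 2) L2inner_vec; (intro T classical_curl_test \<phi> \<psi>)?)
      (simp add: sum_3 classical_curl_nth partial_nth[OF \<phi>] partial_nth[OF \<psi>]
        L2inner_diff_left L2inner_diff_right t p)
qed

text \<open>
  If \<open>\<psi>\<close> is a test field, then so is its curl, and the weak gradient tested against \<open>curl \<psi>\<close> only sees
  \<open>div (curl \<psi>) = 0\<close>.
\<close>

lemma weak_grad_imp_curl_free:
  assumes "is_weak_grad \<Omega> u g" shows "is_weak_curl \<Omega> g (\<lambda>x. 0)"
  unfolding is_weak_curl_def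
proof
  fix \<psi> :: "real^3 \<Rightarrow> real^3" assume \<psi>: "\<psi> \<in> test_functions \<Omega>"
  then show "(LINT x|lebesgue_on \<Omega>. g x \<bullet> classical_curl \<psi> x) = (LINT x|lebesgue_on \<Omega>. 0 \<bullet> \<psi> x)"
    using assms classical_curl_test[OF \<psi>] classical_div_curl[OF \<psi>] by (auto simp: is_weak_grad_def)
qed

section \<open>Sobolev spaces in terms of approximating test functions\<close>

text \<open>
  Weak derivatives are unique almost everywhere, so the representative chosen by \<open>wgrad\<close> may be replaced
  by any weak gradient at hand. The same holds for \<open>wcurl\<close> and \<open>wdiv\<close> below.
\<close>

lemma wgrad_props:
  assumes "open \<Omega>" "g \<in> L2 \<Omega>" "is_weak_grad \<Omega> u g"
  shows "wgrad \<Omega> u \<in> L2 \<Omega>" "is_weak_grad \<Omega> u (wgrad \<Omega> u)"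
    "AE x in lebesgue_on \<Omega>. wgrad \<Omega> u x = g x" "L2norm \<Omega> (wgrad \<Omega> u) = L2norm \<Omega> g"
proof -
  have *: "wgrad \<Omega> u \<in> L2 \<Omega> \<and> is_weak_grad \<Omega> u (wgrad \<Omega> u)"
    unfolding wgrad_def by (rule someI[of _ g]) (use assms in auto)
  then show "wgrad \<Omega> u \<in> L2 \<Omega>" "is_weak_grad \<Omega> u (wgrad \<Omega> u)" by auto
  show "AE x in lebesgue_on \<Omega>. wgrad \<Omega> u x = g x"
    using * assms by (intro weakly_unique) (auto simp: is_weak_grad_iff)
  then show "L2norm \<Omega> (wgrad \<Omega> u) = L2norm \<Omega> g" using * assms by (intro L2norm_cong_AE) auto
qed

lemma wcurl_props:
  assumes "open \<Omega>" "c \<in> L2 \<Omega>" "is_weak_curl \<Omega> w c"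
  shows "wcurl \<Omega> w \<in> L2 \<Omega>" "is_weak_curl \<Omega> w (wcurl \<Omega> w)"
    "AE x in lebesgue_on \<Omega>. wcurl \<Omega> w x = c x" "L2norm \<Omega> (wcurl \<Omega> w) = L2norm \<Omega> c"
proof -
  have *: "wcurl \<Omega> w \<in> L2 \<Omega> \<and> is_weak_curl \<Omega> w (wcurl \<Omega> w)"
    unfolding wcurl_def by (rule someI[of _ c]) (use assms in auto)
  then show "wcurl \<Omega> w \<in> L2 \<Omega>" "is_weak_curl \<Omega> w (wcurl \<Omega> w)" by auto
  show "AE x in lebesgue_on \<Omega>. wcurl \<Omega> w x = c x"
    using * assms by (intro weakly_unique) (auto simp: is_weak_curl_iff)
  then show "L2norm \<Omega> (wcurl \<Omega> w) = L2norm \<Omega> c" using * assms by (intro L2norm_cong_AE) auto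
qed

lemma L2norm_wdiv:
  assumes "open \<Omega>" "d \<in> L2 \<Omega>" "is_weak_div \<Omega> w d"
  shows "L2norm \<Omega> (wdiv \<Omega> w) = L2norm \<Omega> d"
proof -
  have *: "wdiv \<Omega> w \<in> L2 \<Omega> \<and> is_weak_div \<Omega> w (wdiv \<Omega> w)"
    unfolding wdiv_def by (rule someI[of _ d]) (use assms in auto)
  then have "AE x in lebesgue_on \<Omega>. wdiv \<Omega> w x = d x"
    using assms by (intro weakly_unique) (auto simp: is_weak_div_iff)
  then show ?thesis using * assms by (intro L2norm_cong_AE) auto
qed

lemma H_grad_wgrad:
  assumes "open \<Omega>" "u \<in> H_grad \<Omega>"
  shows "u \<in> L2 \<Omega>" "wgrad \<Omega> u \<in> L2 \<Omega>" "is_weak_grad \<Omega> u (wgrad \<Omega> u)"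
  using assms wgrad_props[OF assms(1)] by (auto simp: H_grad_def)

lemma H_curl_wcurl:
  assumes "open \<Omega>" "w \<in> H_curl \<Omega>"
  shows "w \<in> L2 \<Omega>" "wcurl \<Omega> w \<in> L2 \<Omega>" "is_weak_curl \<Omega> w (wcurl \<Omega> w)"
  using assms wcurl_props[OF assms(1)] by (auto simp: H_curl_def)

lemma is_weak_grad_diff:
  assumes "open \<Omega>" "is_weak_grad \<Omega> u g" "is_weak_grad \<Omega> v h" "u \<in> L2 \<Omega>" "v \<in> L2 \<Omega>" "g \<in> L2 \<Omega>" "h \<in> L2 \<Omega>"
  shows "is_weak_grad \<Omega> (\<lambda>x. u x - v x) (\<lambda>x. g x - h x)"
  using assms unfolding is_weak_grad_iff
  by (intro weakly_diff) (auto intro!: test_L2 test_minus classical_div_test)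

lemma is_weak_curl_diff:
  assumes "open \<Omega>" "is_weak_curl \<Omega> u g" "is_weak_curl \<Omega> v h" "u \<in> L2 \<Omega>" "v \<in> L2 \<Omega>" "g \<in> L2 \<Omega>" "h \<in> L2 \<Omega>"
  shows "is_weak_curl \<Omega> (\<lambda>x. u x - v x) (\<lambda>x. g x - h x)"
  using assms unfolding is_weak_curl_iff
  by (intro weakly_diff) (auto intro!: test_L2 classical_curl_test)

lemma less_if_sqrt_sum_squares_less:
  fixes a b e :: real
  assumes "sqrt (a\<^sup>2 + b\<^sup>2) < e" shows "a < e" "b < e"
  using real_sqrt_sum_squares_ge1[of a b] real_sqrt_sum_squares_ge2[of b a] assms by linarith+

lemma H0_grad_approx:
  assumes \<Omega>: "open \<Omega>" and u: "u \<in> H0_grad \<Omega>" and e: "e > 0"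
  shows "\<exists>\<phi>\<in>test_functions \<Omega>. L2norm \<Omega> (\<lambda>x. u x - \<phi> x) < e \<and>
    L2norm \<Omega> (\<lambda>x. wgrad \<Omega> u x - classical_grad \<phi> x) < e"
proof -
  have \<Omega>m: "\<Omega> \<in> sets lebesgue" using \<Omega> by simp
  have uH: "u \<in> H_grad \<Omega>" using u by (simp add: H0_grad_def)
  obtain \<phi> where \<phi>: "\<phi> \<in> test_functions \<Omega>" and less: "H_grad_norm \<Omega> (\<lambda>x. u x - \<phi> x) < e"
    using u e by (auto simp: H0_grad_def)
  note H = H_grad_wgrad[OF \<Omega> uH] and t = test_L2[OF classical_grad_test[OF \<phi>] \<Omega>m]
  have "L2norm \<Omega> (wgrad \<Omega> (\<lambda>x. u x - \<phi> x)) = L2norm \<Omega> (\<lambda>x. wgrad \<Omega> u x - classical_grad \<phi> x)"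
    using is_weak_grad_diff[OF \<Omega> H(3) test_weak_grad[OF \<phi> \<Omega>m] H(1) test_L2[OF \<phi> \<Omega>m] H(2) t]
    by (rule wgrad_props(4)[OF \<Omega> L2_diff[OF H(2) t]])
  with less_if_sqrt_sum_squares_less[OF less[unfolded H_grad_norm_def]] \<phi>
  show ?thesis by auto
qed

lemma H0_grad_limit:
  assumes \<Omega>: "open \<Omega>" and L2: "u \<in> L2 \<Omega>" "g \<in> L2 \<Omega>" and \<phi>: "\<And>k::nat. \<phi> k \<in> test_functions \<Omega>"
    and lim: "(\<lambda>k. L2norm \<Omega> (\<lambda>x. \<phi> k x - u x)) \<longlonglongrightarrow> 0"
      "(\<lambda>k. L2norm \<Omega> (\<lambda>x. classical_grad (\<phi> k) x - g x)) \<longlonglongrightarrow> 0"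
  shows "is_weak_grad \<Omega> u g" "u \<in> H0_grad \<Omega>"
proof -
  have \<Omega>m: "\<Omega> \<in> sets lebesgue" using \<Omega> by simp
  show weak: "is_weak_grad \<Omega> u g"
    unfolding is_weak_grad_iff
  proof (rule weakly_limit[OF _ \<Omega>m _ _ _ L2 lim])
    show "weakly \<Omega> (\<lambda>\<phi> x. - classical_div \<phi> x) (\<phi> k) (classical_grad (\<phi> k))" for k
      using test_weak_grad[OF \<phi> \<Omega>m] by (simp add: is_weak_grad_iff)
  qed (auto intro!: test_L2 test_minus classical_div_test classical_grad_test \<phi> \<Omega>m)
  have "\<exists>\<psi>\<in>test_functions \<Omega>. H_grad_norm \<Omega> (\<lambda>x. u x - \<psi> x) < e" if e: "e > 0" for e
  proof -
    have "(\<lambda>k. L2norm \<Omega> (\<lambda>x. \<phi> k x - u x) + L2norm \<Omega> (\<lambda>x. classical_grad (\<phi> k) x - g x)) \<longlonglongrightarrow> 0"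
      using tendsto_add[OF lim] by simp
    from order_tendstoD(2)[OF this e] obtain k where
      k: "L2norm \<Omega> (\<lambda>x. \<phi> k x - u x) + L2norm \<Omega> (\<lambda>x. classical_grad (\<phi> k) x - g x) < e"
      by (auto simp: eventually_sequentially)
    note t = test_L2[OF classical_grad_test[OF \<phi>] \<Omega>m]
    have "L2norm \<Omega> (wgrad \<Omega> (\<lambda>x. u x - \<phi> k x)) = L2norm \<Omega> (\<lambda>x. g x - classical_grad (\<phi> k) x)"
      using is_weak_grad_diff[OF \<Omega> weak test_weak_grad[OF \<phi> \<Omega>m] L2(1) test_L2[OF \<phi> \<Omega>m] L2(2) t]
      by (rule wgrad_props(4)[OF \<Omega> L2_diff[OF L2(2) t]])
    then have "H_grad_norm \<Omega> (\<lambda>x. u x - \<phi> k x)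
        = sqrt ((L2norm \<Omega> (\<lambda>x. \<phi> k x - u x))\<^sup>2 + (L2norm \<Omega> (\<lambda>x. classical_grad (\<phi> k) x - g x))\<^sup>2)"
      by (simp add: H_grad_norm_def L2norm_diff_commute[of \<Omega> u] L2norm_diff_commute[of \<Omega> g])
    also have "\<dots> < e" by (rule le_less_trans[OF sqrt_sum_squares_le_sum[OF L2norm_nonneg L2norm_nonneg] k])
    finally show ?thesis using \<phi> by blast
  qed
  with L2 weak show "u \<in> H0_grad \<Omega>" by (auto simp: H0_grad_def H_grad_def)
qed

text \<open>
  Test fields have a weak curl, namely the classical one, so the graph norm of \<open>w - \<psi>\<close> can be computed from
  an arbitrary weak curl \<open>c\<close> of \<open>w\<close>.
\<close>

lemma H0_curl_iff_approx:
  assumes \<Omega>: "open \<Omega>" and w: "w \<in> L2 \<Omega>" "c \<in> L2 \<Omega>" "is_weak_curl \<Omega> w c"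
  shows "w \<in> H0_curl \<Omega> \<longleftrightarrow> (\<forall>e>0. \<exists>\<psi>\<in>test_functions \<Omega>. L2norm \<Omega> (\<lambda>x. w x - \<psi> x) < e \<and>
    L2norm \<Omega> (\<lambda>x. c x - classical_curl \<psi> x) < e)"
proof -
  have \<Omega>m: "\<Omega> \<in> sets lebesgue" using \<Omega> by simp
  have n: "H_curl_norm \<Omega> (\<lambda>x. w x - \<psi> x)
      = sqrt ((L2norm \<Omega> (\<lambda>x. w x - \<psi> x))\<^sup>2 + (L2norm \<Omega> (\<lambda>x. c x - classical_curl \<psi> x))\<^sup>2)"
    if \<psi>: "\<psi> \<in> test_functions \<Omega>" for \<psi>
  proof -
    note t = test_L2[OF classical_curl_test[OF \<psi>] \<Omega>m]
    have "L2norm \<Omega> (wcurl \<Omega> (\<lambda>x. w x - \<psi> x)) = L2norm \<Omega> (\<lambda>x. c x - classical_curl \<psi> x)"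
      using is_weak_curl_diff[OF \<Omega> w(3) test_weak_curl[OF \<psi> \<Omega>m] w(1) test_L2[OF \<psi> \<Omega>m] w(2) t]
      by (rule wcurl_props(4)[OF \<Omega> L2_diff[OF w(2) t]])
    then show ?thesis by (simp add: H_curl_norm_def)
  qed
  show ?thesis
  proof
    assume "w \<in> H0_curl \<Omega>"
    then have a: "\<exists>\<psi>\<in>test_functions \<Omega>. H_curl_norm \<Omega> (\<lambda>x. w x - \<psi> x) < e" if "e > 0" for e
      using that by (simp add: H0_curl_def)
    show "\<forall>e>0. \<exists>\<psi>\<in>test_functions \<Omega>. L2norm \<Omega> (\<lambda>x. w x - \<psi> x) < e \<and>
        L2norm \<Omega> (\<lambda>x. c x - classical_curl \<psi> x) < e"
    proof (intro allI impI)
      fix e :: real assume "e > 0"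
      from a[OF this] obtain \<psi> where \<psi>: "\<psi> \<in> test_functions \<Omega>" "H_curl_norm \<Omega> (\<lambda>x. w x - \<psi> x) < e"
        by auto
      from less_if_sqrt_sum_squares_less[OF this(2)[unfolded n[OF \<psi>(1)]]] \<psi>(1)
      show "\<exists>\<psi>\<in>test_functions \<Omega>. L2norm \<Omega> (\<lambda>x. w x - \<psi> x) < e \<and>
        L2norm \<Omega> (\<lambda>x. c x - classical_curl \<psi> x) < e" by auto
    qed
  next
    assume a: "\<forall>e>0. \<exists>\<psi>\<in>test_functions \<Omega>. L2norm \<Omega> (\<lambda>x. w x - \<psi> x) < e \<and>
        L2norm \<Omega> (\<lambda>x. c x - classical_curl \<psi> x) < e"
    have "\<exists>\<psi>\<in>test_functions \<Omega>. H_curl_norm \<Omega> (\<lambda>x. w x - \<psi> x) < e" if e: "e > 0" for e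
    proof -
      obtain \<psi> where \<psi>: "\<psi> \<in> test_functions \<Omega>" "L2norm \<Omega> (\<lambda>x. w x - \<psi> x) < e/2"
        "L2norm \<Omega> (\<lambda>x. c x - classical_curl \<psi> x) < e/2"
        using a[rule_format, OF half_gt_zero[OF e]] by blast
      then have "H_curl_norm \<Omega> (\<lambda>x. w x - \<psi> x) < e"
        unfolding n[OF \<psi>(1)]
        using sqrt_sum_squares_le_sum[OF L2norm_nonneg L2norm_nonneg, of \<Omega> "\<lambda>x. w x - \<psi> x" \<Omega> "\<lambda>x. c x - classical_curl \<psi> x"]
        by linarith
      with \<psi> show ?thesis by blast
    qed
    with w show "w \<in> H0_curl \<Omega>" by (auto simp: H0_curl_def H_curl_def)
  qed
qed

section \<open>Korn's first inequality\<close>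

lemma transpose_nth [simp]: "transpose P $ i $ j = P $ j $ i"
  by (simp add: transpose_def)

lemma norm_sym_part_sq:
  "(norm (sym_part P))\<^sup>2 = 1/2 * (norm P)\<^sup>2 + 1/2 * (P \<bullet> transpose P)"
proof -
  have swap: "P \<bullet> Q = transpose P \<bullet> transpose Q" for P Q :: "real^3^3"
    unfolding inner_vec_def transpose_nth by (rule sum.swap)
  have tt: "transpose (transpose P) = P" by (rule transpose_transpose)
  show ?thesis
    using swap[of P P] swap[of "transpose P" P] tt
    by (simp add: sym_part_def power2_norm_eq_inner inner_add_left inner_add_right algebra_simps)
qed

lemma norm_sym_part_le: "norm (sym_part P) \<le> norm P"
proof -
  have "norm (transpose P) = norm P"
    unfolding norm_eq_sqrt_inner inner_vec_def transpose_nth by (subst sum.swap) (rule refl)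
  then have "norm (P + transpose P) \<le> 2 * norm P"
    using norm_triangle_ineq[of P "transpose P"] by simp
  then show ?thesis by (simp add: sym_part_def)
qed

lemma bounded_linear_transpose: "bounded_linear (transpose :: real^3^3 \<Rightarrow> real^3^3)"
  by (rule linear_conv_bounded_linear[THEN iffD1], rule linearI) (auto simp: vec_eq_iff)

lemma bounded_linear_sym_part: "bounded_linear sym_part"
  unfolding sym_part_def[abs_def]
  by (intro bounded_linear_scaleR_right[THEN bounded_linear_compose] bounded_linear_add bounded_linear_ident bounded_linear_transpose)

text \<open>
  Both sides arise from \<open>a\<close> tested against the mixed second derivative of \<open>b\<close>, which is symmetric.
\<close>

lemma test_by_parts_swap:
  fixes a b :: "real^3 \<Rightarrow> real"
  assumes a: "a \<in> test_functions \<Omega>" and b: "b \<in> test_functions \<Omega>" and \<Omega>: "\<Omega> \<in> sets lebesgue"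
  shows "L2inner \<Omega> (partial j a) (partial n b) = L2inner \<Omega> (partial n a) (partial j b)"
proof -
  have "L2inner \<Omega> a (partial j (partial n b)) = L2inner \<Omega> a (partial n (partial j b))"
    using partial_commute[OF b] by (simp add: L2inner_def)
  then show ?thesis
    using test_by_parts[OF a test_partial[OF b] \<Omega>] by simp
qed

text \<open>
  By the pointwise identity for the symmetric part it suffices that the integral of \<open>P \<bullet> P\<^sup>T\<close> is
  nonnegative. Its terms are \<open>\<partial>\<^sub>j \<phi>\<^sub>n \<partial>\<^sub>n \<phi>\<^sub>j\<close>, and exchanging the two derivatives under the integral
  turns their sum into the square of the divergence of \<open>(\<phi>\<^sub>1, \<phi>\<^sub>2, \<phi>\<^sub>3)\<close>.
\<close>

lemma Korn_test:
  fixes \<phi> :: "3 \<Rightarrow> real^3 \<Rightarrow> real"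
  assumes \<phi>: "\<And>n. \<phi> n \<in> test_functions \<Omega>" and \<Omega>: "\<Omega> \<in> sets lebesgue"
  defines "P \<equiv> \<lambda>x. \<chi> n. classical_grad (\<phi> n) x"
  shows "(L2norm \<Omega> P)\<^sup>2 \<le> 2 * (L2norm \<Omega> (\<lambda>x. sym_part (P x)))\<^sup>2"
proof -
  have P: "P \<in> L2 \<Omega>" unfolding P_def by (intro L2_vec test_L2 classical_grad_test \<phi> \<Omega>)
  have tP: "(\<lambda>x. transpose (P x)) \<in> L2 \<Omega>" by (rule L2_bounded_linear[OF bounded_linear_transpose P])
  have t: "partial i (\<phi> n) \<in> L2 \<Omega>" for i n by (intro test_L2 test_partial \<phi> \<Omega>)
  have int: "integrable (lebesgue_on \<Omega>) (\<lambda>x. partial i (\<phi> n) x * partial j (\<phi> m) x)" for i j n m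
    using L2_inner_integrable[OF t t] by simp
  have "L2inner \<Omega> P (\<lambda>x. transpose (P x))
      = (\<Sum>n\<in>UNIV. \<Sum>j\<in>UNIV. L2inner \<Omega> (partial j (\<phi> n)) (partial n (\<phi> j)))"
    unfolding L2inner_def by (simp add: inner_vec_def P_def classical_grad_def int)
  also have "\<dots> = (\<Sum>n\<in>UNIV. \<Sum>j\<in>UNIV. L2inner \<Omega> (partial n (\<phi> n)) (partial j (\<phi> j)))"
    by (intro sum.cong refl test_by_parts_swap \<phi> \<Omega>)
  also have "\<dots> = (LINT x|lebesgue_on \<Omega>. (\<Sum>n\<in>UNIV. partial n (\<phi> n) x)\<^sup>2)"
    unfolding L2inner_def by (simp add: power2_eq_square sum_product int)
  also have "\<dots> \<ge> 0" by simp
  finally have nonneg: "0 \<le> L2inner \<Omega> P (\<lambda>x. transpose (P x))" .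
  have "(L2norm \<Omega> (\<lambda>x. sym_part (P x)))\<^sup>2
      = (LINT x|lebesgue_on \<Omega>. 1/2 * (norm (P x))\<^sup>2 + 1/2 * (P x \<bullet> transpose (P x)))"
    unfolding norm_sym_part_sq[symmetric] by (simp add: L2norm_def)
  also have "\<dots> = 1/2 * (L2norm \<Omega> P)\<^sup>2 + 1/2 * L2inner \<Omega> P (\<lambda>x. transpose (P x))"
    using P L2_inner_integrable[OF P tP] by (simp add: L2norm_def L2inner_def L2_def)
  finally show ?thesis using nonneg by simp
qed

lemma L2norm_vec_le:
  fixes f :: "real^3 \<Rightarrow> 'b::euclidean_space^3"
  assumes "f \<in> L2 \<Omega>" "\<And>n. L2norm \<Omega> (\<lambda>x. f x $ n) \<le> e"
  shows "L2norm \<Omega> f \<le> 2 * e"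
proof (rule power2_le_imp_le)
  have "0 \<le> e" using assms(2)[of 1] L2norm_nonneg[of \<Omega> "\<lambda>x. f x $ 1"] by linarith
  then show "0 \<le> 2 * e" by simp
  have "(L2norm \<Omega> f)\<^sup>2 = (\<Sum>n\<in>UNIV. (L2norm \<Omega> (\<lambda>x. f x $ n))\<^sup>2)"
    unfolding L2norm_sq by (rule L2inner_vec[OF assms(1,1)])
  also have "\<dots> \<le> (\<Sum>n\<in>(UNIV::3 set). e\<^sup>2)" by (intro sum_mono power_mono assms L2norm_nonneg)
  also have "\<dots> \<le> (2 * e)\<^sup>2" by (simp add: power_mult_distrib)
  finally show "(L2norm \<Omega> f)\<^sup>2 \<le> (2 * e)\<^sup>2" .
qed

lemma wGrad_L2: "open \<Omega> \<Longrightarrow> v \<in> H_Grad \<Omega> \<Longrightarrow> wGrad \<Omega> v \<in> L2 \<Omega>"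
  unfolding wGrad_def[abs_def] by (intro L2_vec H_grad_wgrad) (auto simp: H_Grad_def)

lemma H0_Grad_subset: "H0_Grad \<Omega> \<subseteq> H_Grad \<Omega>"
  by (auto simp: H0_Grad_def H_Grad_def H0_grad_def)

lemma L2norm_sym_part_le:
  assumes "P \<in> L2 \<Omega>" "\<Omega> \<in> sets lebesgue"
  shows "L2norm \<Omega> (\<lambda>x. sym_part (P x)) \<le> L2norm \<Omega> P"
  by (rule L2norm_mono[OF assms(1) L2_bounded_linear[OF bounded_linear_sym_part assms(1)] norm_sym_part_le assms(2)])

lemma Korn_H0:
  assumes \<Omega>: "open \<Omega>" and v: "v \<in> H0_Grad \<Omega>"
  shows "L2norm \<Omega> (wGrad \<Omega> v) \<le> 2 * L2norm \<Omega> (\<lambda>x. sym_part (wGrad \<Omega> v x))"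
proof (rule field_le_epsilon)
  fix e :: real assume "e > 0"
  have \<Omega>m: "\<Omega> \<in> sets lebesgue" using \<Omega> by simp
  let ?G = "wGrad \<Omega> v" let ?s = "\<lambda>P x. sym_part (P x)"
  have G: "?G \<in> L2 \<Omega>" using wGrad_L2[OF \<Omega>] v H0_Grad_subset by blast
  have "\<forall>n. \<exists>\<phi>. \<phi> \<in> test_functions \<Omega> \<and>
      L2norm \<Omega> (\<lambda>x. wgrad \<Omega> (\<lambda>x. v x $ n) x - classical_grad \<phi> x) < e / 6"
  proof
    fix n
    have "(\<lambda>x. v x $ n) \<in> H0_grad \<Omega>" "e / 6 > 0" using v \<open>e > 0\<close> by (auto simp: H0_Grad_def)
    from H0_grad_approx[OF \<Omega> this]
    show "\<exists>\<phi>. \<phi> \<in> test_functions \<Omega> \<and>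
        L2norm \<Omega> (\<lambda>x. wgrad \<Omega> (\<lambda>x. v x $ n) x - classical_grad \<phi> x) < e / 6" by blast
  qed
  from choice[OF this] obtain \<phi> where \<phi>: "\<And>n. \<phi> n \<in> test_functions \<Omega>"
    and close: "\<And>n. L2norm \<Omega> (\<lambda>x. wgrad \<Omega> (\<lambda>x. v x $ n) x - classical_grad (\<phi> n) x) < e / 6" by blast
  define P where "P = (\<lambda>x. \<chi> n. classical_grad (\<phi> n) x)"
  have P: "P \<in> L2 \<Omega>" unfolding P_def by (intro L2_vec test_L2 classical_grad_test \<phi> \<Omega>m)
  have sL: "?s Q \<in> L2 \<Omega>" if "Q \<in> L2 \<Omega>" for Q by (rule L2_bounded_linear[OF bounded_linear_sym_part that])
  have GP: "L2norm \<Omega> (\<lambda>x. ?G x - P x) \<le> 2 * (e / 6)"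
  proof (rule L2norm_vec_le[OF L2_diff[OF G P]])
    show "L2norm \<Omega> (\<lambda>x. (?G x - P x) $ n) \<le> e / 6" for n
      using close[of n] by (simp add: wGrad_def P_def)
  qed
  have "L2norm \<Omega> (\<lambda>x. ?s P x - ?s ?G x) \<le> 2 * (e / 6)"
  proof -
    have "(\<lambda>x. ?s P x - ?s ?G x) = ?s (\<lambda>x. P x - ?G x)"
      by (simp add: linear_diff[OF bounded_linear.linear[OF bounded_linear_sym_part]])
    then show ?thesis
      using L2norm_sym_part_le[OF L2_diff[OF P G] \<Omega>m] GP by (simp add: L2norm_diff_commute[of \<Omega> P])
  qed
  then have sP: "L2norm \<Omega> (?s P) \<le> L2norm \<Omega> (?s ?G) + e / 3"
    using L2norm_le_add_dist[OF sL[OF P] sL[OF G]] by simp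
  have "(L2norm \<Omega> P)\<^sup>2 \<le> 2 * (L2norm \<Omega> (?s P))\<^sup>2" unfolding P_def by (rule Korn_test[OF \<phi> \<Omega>m])
  also have "\<dots> \<le> (2 * L2norm \<Omega> (?s P))\<^sup>2" by (simp add: power_mult_distrib)
  finally have "L2norm \<Omega> P \<le> 2 * L2norm \<Omega> (?s P)" by (rule power2_le_imp_le) (simp add: L2norm_nonneg)
  then show "L2norm \<Omega> ?G \<le> 2 * L2norm \<Omega> (?s ?G) + e"
    using sP L2norm_le_add_dist[OF G P] GP by simp
qed

section \<open>Potentials of curl-free fields\<close>

lemma classical_grad_add_scaleR:
  assumes "\<phi> \<in> test_functions \<Omega>" "\<psi> \<in> test_functions \<Omega>"
  shows "classical_grad (\<lambda>x. \<phi> x + a *\<^sub>R \<psi> x) = (\<lambda>x. classical_grad \<phi> x + a *\<^sub>R classical_grad \<psi> x)"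
  using partial_add[OF assms(1) test_scaleR[OF assms(2)]] partial_scaleR[OF assms(2)]
  by (simp add: classical_grad_def vec_eq_iff fun_eq_iff)

lemma test_Poincare_grad:
  assumes \<phi>: "\<phi> \<in> test_functions \<Omega>" and \<Omega>: "\<Omega> \<in> sets lebesgue"
    and R: "R \<ge> 0" "\<And>x. x \<in> \<Omega> \<Longrightarrow> norm x \<le> R"
  shows "L2norm \<Omega> \<phi> \<le> 2 * R * L2norm \<Omega> (classical_grad \<phi>)"
proof -
  have "L2norm \<Omega> (partial 1 \<phi>) \<le> L2norm \<Omega> (classical_grad \<phi>)"
  proof (rule L2norm_mono[OF test_L2[OF classical_grad_test[OF \<phi>] \<Omega>] test_L2[OF test_partial[OF \<phi>] \<Omega>] _ \<Omega>])
    show "norm (partial 1 \<phi> x) \<le> norm (classical_grad \<phi> x)" for x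
      using component_le_norm_cart[of "classical_grad \<phi> x" 1] by (simp add: classical_grad_def)
  qed
  then have "2 * R * L2norm \<Omega> (partial 1 \<phi>) \<le> 2 * R * L2norm \<Omega> (classical_grad \<phi>)"
    using R(1) by (intro mult_left_mono) auto
  with test_Poincare[OF \<phi> \<Omega> R] show ?thesis by (rule order_trans)
qed

text \<open>
  By the Poincare inequality the potentials converge as soon as their gradients do. So the
  closure of the gradients of test functions in \<open>L2\<close> consists of gradients of \<open>H0_grad\<close>.
\<close>

lemma gradient_limit_has_potential:
  assumes \<Omega>: "open \<Omega>" "bounded \<Omega>" and \<phi>: "\<And>k::nat. \<phi> k \<in> test_functions \<Omega>" and g: "g \<in> L2 \<Omega>"
    and lim: "(\<lambda>k. L2norm \<Omega> (\<lambda>x. classical_grad (\<phi> k) x - g x)) \<longlonglongrightarrow> 0"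
  shows "\<exists>u\<in>H0_grad \<Omega>. is_weak_grad \<Omega> u g"
proof -
  have \<Omega>m: "\<Omega> \<in> sets lebesgue" using \<Omega>(1) by simp
  obtain R where R: "R > 0" "\<And>x. x \<in> \<Omega> \<Longrightarrow> norm x \<le> R" using \<Omega>(2) by (auto simp: bounded_pos)
  have \<phi>L: "\<phi> k \<in> L2 \<Omega>" and gL: "classical_grad (\<phi> k) \<in> L2 \<Omega>" for k
    by (intro test_L2 classical_grad_test \<phi> \<Omega>m)+
  define \<delta> where "\<delta> k = L2norm \<Omega> (\<lambda>x. classical_grad (\<phi> k) x - g x)" for k
  have dist: "L2norm \<Omega> (\<lambda>x. \<phi> m x - \<phi> n x) \<le> 2 * R * (\<delta> m + \<delta> n)" for m n
  proof -
    have "classical_grad (\<lambda>x. \<phi> m x - \<phi> n x) = (\<lambda>x. classical_grad (\<phi> m) x - classical_grad (\<phi> n) x)"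
      using classical_grad_add_scaleR[OF \<phi> \<phi>, of m "-1" n] by simp
    then have "L2norm \<Omega> (\<lambda>x. \<phi> m x - \<phi> n x)
        \<le> 2 * R * L2norm \<Omega> (\<lambda>x. classical_grad (\<phi> m) x - classical_grad (\<phi> n) x)"
      using test_Poincare_grad[OF test_diff[OF \<phi> \<phi>] \<Omega>m _ R(2), of m n] R(1) by simp
    also have "\<dots> \<le> 2 * R * (\<delta> m + \<delta> n)"
      using L2dist_triangle[OF gL g gL, of m n] R(1)
      by (intro mult_left_mono) (simp_all add: \<delta>_def L2norm_diff_commute[of \<Omega> g])
    finally show ?thesis .
  qed
  have "\<exists>N. \<forall>m\<ge>N. \<forall>n\<ge>N. L2norm \<Omega> (\<lambda>x. \<phi> m x - \<phi> n x) < e" if "e > 0" for e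
  proof -
    have "e / (4 * R) > 0" using that R by simp
    from order_tendstoD(2)[OF lim this] obtain N where N: "\<And>k. k \<ge> N \<Longrightarrow> \<delta> k < e / (4 * R)"
      by (auto simp: eventually_sequentially \<delta>_def)
    have "L2norm \<Omega> (\<lambda>x. \<phi> m x - \<phi> n x) < e" if "m \<ge> N" "n \<ge> N" for m n
    proof -
      have "\<delta> m + \<delta> n < e / (2 * R)" using N[OF that(1)] N[OF that(2)] by (simp add: field_simps)
      then have "2 * R * (\<delta> m + \<delta> n) < e" using R by (simp add: field_simps)
      with dist[of m n] show ?thesis by simp
    qed
    then show ?thesis by blast
  qed
  from L2_complete[OF \<phi>L this] obtain u where "u \<in> L2 \<Omega>" "(\<lambda>k. L2norm \<Omega> (\<lambda>x. \<phi> k x - u x)) \<longlonglongrightarrow> 0"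
    by auto
  from H0_grad_limit[OF \<Omega>(1) this(1) g \<phi> this(2) lim] show ?thesis by blast
qed

text \<open>
  The projection of \<open>w\<close> onto the closure of the gradients of test functions is the gradient \<open>g\<close> of some \<open>u\<close>
  in \<open>H0_grad\<close>. The remainder \<open>r = w - g\<close> is orthogonal to these gradients, that is, its weak divergence
  vanishes. It is also curl-free and in \<open>H0_curl\<close>, being approximated by differences of test fields for
  \<open>w\<close> and gradients of test functions. So the Maxwell estimate forces \<open>r = 0\<close>.
\<close>

lemma curl_free_has_potential:
  assumes \<Omega>: "open \<Omega>" "bounded \<Omega>"
    and Maxwell: "\<And>w. w \<in> H0_curl \<Omega> \<Longrightarrow> w \<in> H_div \<Omega> \<Longrightarrow>
           L2norm \<Omega> w \<le> c * sqrt ((L2norm \<Omega> (wcurl \<Omega> w))\<^sup>2 + (L2norm \<Omega> (wdiv \<Omega> w))\<^sup>2)"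
    and w: "w \<in> H0_curl \<Omega>" "is_weak_curl \<Omega> w (\<lambda>x. 0)"
  shows "\<exists>u\<in>H0_grad \<Omega>. AE x in lebesgue_on \<Omega>. w x = wgrad \<Omega> u x"
proof -
  have \<Omega>m: "\<Omega> \<in> sets lebesgue" using \<Omega>(1) by simp
  have wL: "w \<in> L2 \<Omega>" using w(1) by (simp add: H0_curl_def H_curl_def)
  define V where "V = classical_grad ` test_functions \<Omega>"
  have V_L2: "V \<subseteq> L2 \<Omega>" unfolding V_def by (auto intro: test_L2 classical_grad_test \<Omega>m)
  have V_ne: "V \<noteq> {}" unfolding V_def using test_zero by blast
  have V_lin: "(\<lambda>x. f x + a *\<^sub>R h x) \<in> V" if fh: "f \<in> V" "h \<in> V" for f h a
  proof -
    obtain \<phi> \<psi> where *: "\<phi> \<in> test_functions \<Omega>" "\<psi> \<in> test_functions \<Omega>" "f = classical_grad \<phi>" "h = classical_grad \<psi>"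
      using fh by (auto simp: V_def)
    show ?thesis
      unfolding V_def *(3,4) classical_grad_add_scaleR[OF *(1,2), symmetric]
      by (rule imageI[OF test_add[OF *(1) test_scaleR[OF *(2)]]])
  qed
  obtain v g where v: "\<And>k::nat. v k \<in> V" and g: "g \<in> L2 \<Omega>"
    and lim: "(\<lambda>k. L2norm \<Omega> (\<lambda>x. v k x - g x)) \<longlonglongrightarrow> 0"
    and orth: "\<And>h. h \<in> V \<Longrightarrow> L2inner \<Omega> (\<lambda>x. w x - g x) h = 0"
    using L2_projection[OF V_L2 V_ne V_lin wL] by blast
  have "\<exists>\<phi>. \<forall>k. \<phi> k \<in> test_functions \<Omega> \<and> v k = classical_grad (\<phi> k)"
    using v unfolding V_def by (intro choice) auto
  then obtain \<phi> where \<phi>: "\<And>k. \<phi> k \<in> test_functions \<Omega>" and v_eq: "\<And>k. v k = classical_grad (\<phi> k)" by blast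
  have lim': "(\<lambda>k. L2norm \<Omega> (\<lambda>x. classical_grad (\<phi> k) x - g x)) \<longlonglongrightarrow> 0" using lim by (simp add: v_eq)
  obtain u where u: "u \<in> H0_grad \<Omega>" "is_weak_grad \<Omega> u g"
    using gradient_limit_has_potential[OF \<Omega> \<phi> g lim'] by blast
  define r where "r x = w x - g x" for x
  have r: "r \<in> L2 \<Omega>" unfolding r_def[abs_def] by (rule L2_diff[OF wL g])
  have "is_weak_div \<Omega> r (\<lambda>x. 0)"
    unfolding is_weak_div_def
  proof
    fix \<psi> :: "real^3 \<Rightarrow> real" assume "\<psi> \<in> test_functions \<Omega>"
    then have "L2inner \<Omega> r (classical_grad \<psi>) = 0"
      unfolding r_def[abs_def] by (intro orth) (simp add: V_def)
    then show "(LINT x|lebesgue_on \<Omega>. r x \<bullet> classical_grad \<psi> x) = - (LINT x|lebesgue_on \<Omega>. 0 * \<psi> x)"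
      by (simp add: L2inner_def)
  qed
  then have div: "r \<in> H_div \<Omega>" "L2norm \<Omega> (wdiv \<Omega> r) = 0"
    using r L2norm_wdiv[OF \<Omega>(1) L2_zero] L2_zero by (auto simp: H_div_def L2norm_zero)
  have curl: "is_weak_curl \<Omega> r (\<lambda>x. 0)"
    using is_weak_curl_diff[OF \<Omega>(1) w(2) weak_grad_imp_curl_free[OF u(2)] wL g L2_zero L2_zero]
    by (simp add: r_def[abs_def])
  have H0: "r \<in> H0_curl \<Omega>"
    unfolding H0_curl_iff_approx[OF \<Omega>(1) r L2_zero curl]
  proof (intro allI impI)
    fix e :: real assume "e > 0"
    then obtain \<psi> where \<psi>: "\<psi> \<in> test_functions \<Omega>" "L2norm \<Omega> (\<lambda>x. w x - \<psi> x) < e / 2"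
        "L2norm \<Omega> (\<lambda>x. 0 - classical_curl \<psi> x) < e / 2"
      using H0_curl_iff_approx[OF \<Omega>(1) wL L2_zero w(2)] w(1) half_gt_zero by blast
    from order_tendstoD(2)[OF lim' half_gt_zero[OF \<open>e > 0\<close>]]
    obtain k where k: "L2norm \<Omega> (\<lambda>x. classical_grad (\<phi> k) x - g x) < e / 2"
      by (auto simp: eventually_sequentially)
    let ?\<eta> = "\<lambda>x. \<psi> x - classical_grad (\<phi> k) x"
    have gt: "classical_grad (\<phi> k) \<in> test_functions \<Omega>" by (rule classical_grad_test[OF \<phi>])
    have \<eta>: "?\<eta> \<in> test_functions \<Omega>" by (rule test_diff[OF \<psi>(1) gt])
    have L: "\<psi> \<in> L2 \<Omega>" "classical_grad (\<phi> k) \<in> L2 \<Omega>" by (intro test_L2 \<psi> gt \<Omega>m)+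
    have "L2norm \<Omega> (\<lambda>x. r x - ?\<eta> x) = L2norm \<Omega> (\<lambda>x. (w x - \<psi> x) + (classical_grad (\<phi> k) x - g x))"
      by (simp add: r_def algebra_simps)
    also have "\<dots> < e"
      using L2norm_triangle[OF L2_diff[OF wL L(1)] L2_diff[OF L(2) g]] \<psi>(2) k by simp
    finally have 1: "L2norm \<Omega> (\<lambda>x. r x - ?\<eta> x) < e" .
    \<comment> \<open>Subtracting a gradient leaves the curl unchanged; uniqueness of the weak curl yields this almost everywhere.\<close>
    have "is_weak_curl \<Omega> ?\<eta> (\<lambda>x. classical_curl \<psi> x - 0)"
      by (rule is_weak_curl_diff[OF \<Omega>(1) test_weak_curl[OF \<psi>(1) \<Omega>m]
            weak_grad_imp_curl_free[OF test_weak_grad[OF \<phi> \<Omega>m]] L test_L2[OF classical_curl_test[OF \<psi>(1)] \<Omega>m] L2_zero])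
    then have "AE x in lebesgue_on \<Omega>. classical_curl ?\<eta> x = classical_curl \<psi> x - 0"
      using test_weak_curl[OF \<eta> \<Omega>m] unfolding is_weak_curl_iff
      by (intro weakly_unique[OF \<Omega>(1)] L2_diff L2_zero test_L2 classical_curl_test \<eta> \<psi>(1) \<Omega>m)
    then have "L2norm \<Omega> (\<lambda>x. 0 - classical_curl ?\<eta> x) = L2norm \<Omega> (\<lambda>x. 0 - classical_curl \<psi> x)"
      by (intro L2norm_cong_AE L2_diff L2_zero test_L2 classical_curl_test \<eta> \<psi>(1) \<Omega>m) auto
    with \<psi>(3) \<open>e > 0\<close> have 2: "L2norm \<Omega> (\<lambda>x. 0 - classical_curl ?\<eta> x) < e" by simp
    show "\<exists>\<eta>\<in>test_functions \<Omega>. L2norm \<Omega> (\<lambda>x. r x - \<eta> x) < e \<and> L2norm \<Omega> (\<lambda>x. 0 - classical_curl \<eta> x) < e"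
      by (intro bexI[OF _ \<eta>] conjI 1 2)
  qed
  have "L2norm \<Omega> (wcurl \<Omega> r) = 0" using wcurl_props(4)[OF \<Omega>(1) L2_zero curl] by (simp add: L2norm_zero)
  then have "L2norm \<Omega> r = 0" using Maxwell[OF H0 div(1)] div(2) L2norm_nonneg[of \<Omega> r] by simp
  from L2norm_eq_0_imp_AE[OF r this] wgrad_props(3)[OF \<Omega>(1) g u(2)]
  have "AE x in lebesgue_on \<Omega>. w x = wgrad \<Omega> u x" by eventually_elim (simp add: r_def)
  with u(1) show ?thesis by blast
qed

text \<open>
  Gradients of approximating test functions are themselves test fields, and they are curl-free; so they
  approximate \<open>w\<close> in the graph norm of the curl.
\<close>

lemma wgrad_in_H0_curl:
  assumes \<Omega>: "open \<Omega>" and u: "u \<in> H0_grad \<Omega>" and w: "w \<in> L2 \<Omega>" "AE x in lebesgue_on \<Omega>. w x = wgrad \<Omega> u x"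
  shows "w \<in> H0_curl \<Omega>" "is_weak_curl \<Omega> w (\<lambda>x. 0)"
proof -
  have \<Omega>m: "\<Omega> \<in> sets lebesgue" using \<Omega> by simp
  have G: "wgrad \<Omega> u \<in> L2 \<Omega>" "is_weak_grad \<Omega> u (wgrad \<Omega> u)"
    using u H_grad_wgrad[OF \<Omega>] by (auto simp: H0_grad_def)
  have "L2inner \<Omega> w \<psi> = L2inner \<Omega> (wgrad \<Omega> u) \<psi>" if "\<psi> \<in> L2 \<Omega>" for \<psi>
    by (rule L2inner_cong_AE[OF w(1) G(1) that w(2)])
  then show curl: "is_weak_curl \<Omega> w (\<lambda>x. 0)"
    using weak_grad_imp_curl_free[OF G(2)] test_L2[OF classical_curl_test \<Omega>m]
    by (simp add: is_weak_curl_iff weakly_def)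
  show "w \<in> H0_curl \<Omega>"
    unfolding H0_curl_iff_approx[OF \<Omega> w(1) L2_zero curl]
  proof (intro allI impI)
    fix e :: real assume "e > 0"
    obtain \<phi> where \<phi>: "\<phi> \<in> test_functions \<Omega>" "L2norm \<Omega> (\<lambda>x. wgrad \<Omega> u x - classical_grad \<phi> x) < e"
      using H0_grad_approx[OF \<Omega> u \<open>e > 0\<close>] by blast
    have gt: "classical_grad \<phi> \<in> test_functions \<Omega>" by (rule classical_grad_test[OF \<phi>(1)])
    have ct: "classical_curl (classical_grad \<phi>) \<in> L2 \<Omega>" by (intro test_L2 classical_curl_test gt \<Omega>m)
    have "L2norm \<Omega> (\<lambda>x. w x - classical_grad \<phi> x) = L2norm \<Omega> (\<lambda>x. wgrad \<Omega> u x - classical_grad \<phi> x)"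
      using w(2) by (intro L2norm_cong_AE L2_diff w(1) G(1) test_L2 gt \<Omega>m) auto
    with \<phi> have 1: "L2norm \<Omega> (\<lambda>x. w x - classical_grad \<phi> x) < e" by simp
    have "AE x in lebesgue_on \<Omega>. classical_curl (classical_grad \<phi>) x = 0"
      using test_weak_curl[OF gt \<Omega>m] weak_grad_imp_curl_free[OF test_weak_grad[OF \<phi>(1) \<Omega>m]]
      unfolding is_weak_curl_iff by (rule weakly_unique[OF \<Omega> _ _ ct L2_zero])
    then have "L2norm \<Omega> (\<lambda>x. 0 - classical_curl (classical_grad \<phi>) x) = L2norm \<Omega> (\<lambda>x::real^3. 0 :: real^3)"
      by (intro L2norm_cong_AE L2_diff L2_zero ct) auto
    then have 2: "L2norm \<Omega> (\<lambda>x. 0 - classical_curl (classical_grad \<phi>) x) < e"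
      using \<open>e > 0\<close> by (simp add: L2norm_zero)
    show "\<exists>\<eta>\<in>test_functions \<Omega>. L2norm \<Omega> (\<lambda>x. w x - \<eta> x) < e \<and> L2norm \<Omega> (\<lambda>x. 0 - classical_curl \<eta> x) < e"
      by (intro bexI[OF _ gt] conjI 1 2)
  qed
qed

lemma H0_Curl0_iff:
  assumes \<Omega>: "open \<Omega>"
  shows "P \<in> H0_Curl0 \<Omega> \<longleftrightarrow> (\<forall>n. (\<lambda>x. P x $ n) \<in> H0_curl \<Omega> \<and> is_weak_curl \<Omega> (\<lambda>x. P x $ n) (\<lambda>x. 0))"
proof -
  have \<Omega>m: "\<Omega> \<in> sets lebesgue" using \<Omega> by simp
  have row: "(AE x in lebesgue_on \<Omega>. wcurl \<Omega> w x = 0) \<longleftrightarrow> is_weak_curl \<Omega> w (\<lambda>x. 0)"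
    if "w \<in> H0_curl \<Omega>" for w
  proof
    have W: "wcurl \<Omega> w \<in> L2 \<Omega>" "is_weak_curl \<Omega> w (wcurl \<Omega> w)"
      using that H_curl_wcurl[OF \<Omega>] by (auto simp: H0_curl_def)
    assume ae: "AE x in lebesgue_on \<Omega>. wcurl \<Omega> w x = 0"
    have "L2inner \<Omega> (wcurl \<Omega> w) \<psi> = L2inner \<Omega> (\<lambda>x. 0) \<psi>" if "\<psi> \<in> test_functions \<Omega>" for \<psi>
      by (rule L2inner_cong_AE[OF W(1) L2_zero test_L2[OF that \<Omega>m] ae])
    with W(2) show "is_weak_curl \<Omega> w (\<lambda>x. 0)" by (simp add: is_weak_curl_iff weakly_def)
  next
    assume "is_weak_curl \<Omega> w (\<lambda>x. 0)"
    from wcurl_props(3)[OF \<Omega> L2_zero this] show "AE x in lebesgue_on \<Omega>. wcurl \<Omega> w x = 0" .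
  qed
  have "(AE x in lebesgue_on \<Omega>. wCurl \<Omega> P x = 0)
      \<longleftrightarrow> (AE x in lebesgue_on \<Omega>. \<forall>n\<in>UNIV. wcurl \<Omega> (\<lambda>y. P y $ n) x = 0)"
    by (simp add: wCurl_def vec_eq_iff)
  also have "\<dots> \<longleftrightarrow> (\<forall>n. AE x in lebesgue_on \<Omega>. wcurl \<Omega> (\<lambda>y. P y $ n) x = 0)"
    by (subst AE_finite_all) auto
  finally show ?thesis
    using row by (auto simp: H0_Curl0_def H0_Curl_def)
qed

lemma Grad_image_eq:
  assumes \<Omega>: "open \<Omega>" "bounded \<Omega>"
    and Maxwell: "\<And>w. w \<in> H0_curl \<Omega> \<Longrightarrow> w \<in> H_div \<Omega> \<Longrightarrow>
           L2norm \<Omega> w \<le> c * sqrt ((L2norm \<Omega> (wcurl \<Omega> w))\<^sup>2 + (L2norm \<Omega> (wdiv \<Omega> w))\<^sup>2)"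
  shows "Grad_image \<Omega> (H0_Grad \<Omega>) = H0_Curl0 \<Omega>"
proof (intro set_eqI iffI)
  fix P assume "P \<in> Grad_image \<Omega> (H0_Grad \<Omega>)"
  then obtain v where P: "P \<in> L2 \<Omega>" and v: "v \<in> H0_Grad \<Omega>" and ae: "AE x in lebesgue_on \<Omega>. P x = wGrad \<Omega> v x"
    by (auto simp: Grad_image_def)
  have "(\<lambda>x. P x $ n) \<in> H0_curl \<Omega> \<and> is_weak_curl \<Omega> (\<lambda>x. P x $ n) (\<lambda>x. 0)" for n
  proof -
    have row: "AE x in lebesgue_on \<Omega>. P x $ n = wgrad \<Omega> (\<lambda>y. v y $ n) x"
      using ae by eventually_elim (simp add: wGrad_def)
    have "(\<lambda>y. v y $ n) \<in> H0_grad \<Omega>" using v by (simp add: H0_Grad_def)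
    from wgrad_in_H0_curl[OF \<Omega>(1) this L2_nth[OF P] row] show ?thesis ..
  qed
  then show "P \<in> H0_Curl0 \<Omega>" by (simp add: H0_Curl0_iff[OF \<Omega>(1)])
next
  fix P assume "P \<in> H0_Curl0 \<Omega>"
  then have rows: "(\<lambda>x. P x $ n) \<in> H0_curl \<Omega>" "is_weak_curl \<Omega> (\<lambda>x. P x $ n) (\<lambda>x. 0)" for n
    by (auto simp: H0_Curl0_iff[OF \<Omega>(1)])
  have "\<exists>u. \<forall>n. u n \<in> H0_grad \<Omega> \<and> (AE x in lebesgue_on \<Omega>. P x $ n = wgrad \<Omega> (u n) x)"
    using curl_free_has_potential[OF \<Omega> Maxwell rows] by (intro choice) blast
  then obtain u where u: "\<And>n. u n \<in> H0_grad \<Omega>"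
    and ae: "\<And>n. AE x in lebesgue_on \<Omega>. P x $ n = wgrad \<Omega> (u n) x" by blast
  define v where "v x = (\<chi> n. u n x)" for x
  have comp: "(\<lambda>x. v x $ n) = u n" for n by (simp add: v_def)
  have "v \<in> H0_Grad \<Omega>" by (simp add: H0_Grad_def comp u)
  moreover have "AE x in lebesgue_on \<Omega>. \<forall>n\<in>UNIV. P x $ n = wgrad \<Omega> (u n) x"
    using ae by (subst AE_finite_all) auto
  then have "AE x in lebesgue_on \<Omega>. P x = wGrad \<Omega> v x"
    by eventually_elim (simp add: wGrad_def comp vec_eq_iff)
  moreover have "(\<lambda>x. \<chi> n. P x $ n) \<in> L2 \<Omega>"
    using rows by (intro L2_vec) (simp add: H0_curl_def H_curl_def)
  then have "P \<in> L2 \<Omega>" by simp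
  ultimately show "P \<in> Grad_image \<Omega> (H0_Grad \<Omega>)" by (auto simp: Grad_image_def)
qed

section \<open>Korn's inequality for fields with normal gradients\<close>

theorem mainTheorem3:
  fixes \<Omega> :: "(real^3) set" and c\<^sub>m c :: real
  assumes "bounded_lipschitz_domain \<Omega>"
    and "connected (frontier \<Omega>)"
    and "c\<^sub>m > 0"
    and "\<forall>w \<in> H0_curl \<Omega> \<inter> H_div \<Omega>.
           L2norm \<Omega> w \<le> c\<^sub>m * sqrt ((L2norm \<Omega> (wcurl \<Omega> w))\<^sup>2 + (L2norm \<Omega> (wdiv \<Omega> w))\<^sup>2)"
    and "c = max 2 (sqrt 5 * c\<^sub>m)"
  shows "(\<forall>v \<in> H0_Grad \<Omega>. L2norm \<Omega> (wGrad \<Omega> v) \<le> c * L2norm \<Omega> (\<lambda>x. sym_part (wGrad \<Omega> v x)))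
    \<and> (Grad_image \<Omega> (H0_Grad \<Omega>) = H0_Curl0 \<Omega>
       \<and> (\<forall>v \<in> H_Grad \<Omega>. wGrad \<Omega> v \<in> H0_Curl0 \<Omega> \<longrightarrow>
            L2norm \<Omega> (wGrad \<Omega> v) \<le> c * L2norm \<Omega> (\<lambda>x. sym_part (wGrad \<Omega> v x))))"
proof -
  have \<Omega>: "open \<Omega>" "bounded \<Omega>" using assms(1) by (auto simp: bounded_lipschitz_domain_def)
  have image: "Grad_image \<Omega> (H0_Grad \<Omega>) = H0_Curl0 \<Omega>"
    by (rule Grad_image_eq[OF \<Omega>]) (use assms(4) in blast)
  have Korn: "L2norm \<Omega> (wGrad \<Omega> v) \<le> c * L2norm \<Omega> (\<lambda>x. sym_part (wGrad \<Omega> v x))"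
    if v: "v \<in> H0_Grad \<Omega>" for v
  proof -
    have "2 * L2norm \<Omega> (\<lambda>x. sym_part (wGrad \<Omega> v x)) \<le> c * L2norm \<Omega> (\<lambda>x. sym_part (wGrad \<Omega> v x))"
      by (rule mult_right_mono) (simp_all add: assms(5) L2norm_nonneg)
    with Korn_H0[OF \<Omega>(1) v] show ?thesis by (rule order_trans)
  qed
  have "L2norm \<Omega> (wGrad \<Omega> v) \<le> c * L2norm \<Omega> (\<lambda>x. sym_part (wGrad \<Omega> v x))"
    if v: "v \<in> H_Grad \<Omega>" and normal: "wGrad \<Omega> v \<in> H0_Curl0 \<Omega>" for v
  proof -
    from normal obtain u where u: "u \<in> H0_Grad \<Omega>" and ae: "AE x in lebesgue_on \<Omega>. wGrad \<Omega> v x = wGrad \<Omega> u x"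
      unfolding image[symmetric] by (auto simp: Grad_image_def)
    have L: "wGrad \<Omega> v \<in> L2 \<Omega>" "wGrad \<Omega> u \<in> L2 \<Omega>"
      using wGrad_L2[OF \<Omega>(1)] v u H0_Grad_subset by blast+
    have "L2norm \<Omega> (wGrad \<Omega> v) = L2norm \<Omega> (wGrad \<Omega> u)" by (rule L2norm_cong_AE[OF L ae])
    moreover have "L2norm \<Omega> (\<lambda>x. sym_part (wGrad \<Omega> v x)) = L2norm \<Omega> (\<lambda>x. sym_part (wGrad \<Omega> u x))"
      by (rule L2norm_cong_AE) (use ae in \<open>auto intro: L2_bounded_linear[OF bounded_linear_sym_part] L\<close>)
    ultimately show ?thesis using Korn[OF u] by simp
  qed
  with Korn image show ?thesis by blast
qed

end
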